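(* For every $\varepsilon\in(0,1/2)$, \[ \lim_{K\to\infty}\mathbb{E}\left[\frac{1}{K}\left|\mathrm{BoA}_K\left(\eta_{\lfloor\varepsilon K\rfloor}\right)\right|\right]=\exp\left\{\sqrt{1-2\varepsilon}\right\}. \]
   Context: For an integer $K\ge 2$ let $[K]=\{1,\dots,K\}$. A (strict ordinal) potential on $[K]\times[K]$ is a bijection $\Psi:[K]\times[K]\to[K^2]$; it represents a two-player game in which player A chooses the first coordinate (row) $a$, player B chooses the second coordinate (column) $b$, and lower potential is better for both players (given the other player's action). The random potential $\Psi$ is chosen uniformly at random among all $(K^2)!$ such bijections. A pure Nash equilibrium (PNE) is a profile $(a^*,b^* )$ such that $\Psi(a^*,b^* )\le\Psi(a,b^* )$ for all $a$ and $\Psi(a^*,b^* )\le\Psi(a^*,b)$ for all $b$. Let $W_K$ be the number of PNE and order them by increasing potential as $\eta_1,\dots,\eta_{W_K}$ ($\eta_1$ has the smallest potential). Best-response dynamics (BRD) from a starting profile $(a_0,b_0)$: $\mathrm{BRD}(0)=(a_0,b_0)$; if $\mathrm{BRD}(t)=(a',b')$ and $t$ is even, then $\mathrm{BRD}(t+1)=(a'',b')$ where $a''$ is the element of $\arg\min_{a\in[K]}\Psi(a,b')\setminus\{a'\}$ if this set is nonempty, and $\mathrm{BRD}(t+1)=\mathrm{BRD}(t)$ otherwise; if $t$ is odd, then $\mathrm{BRD}(t+1)=(a',b'')$ where $b''$ is the element of $\arg\min_{b\in[K]}\Psi(a',b)\setminus\{b'\}$ if nonempty, and $\mathrm{BRD}(t+1)=\mathrm{BRD}(t)$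 otherwise. The dynamics is absorbed at a PNE within $2K$ steps, and $\mathrm{BRD}(2K)$ denotes that PNE. The basin of attraction of a PNE $\eta$ is $\mathrm{BoA}_K(\eta)=\{(a,b)\in[K]^2:\ \text{if }\mathrm{BRD}(0)=(a,b)\text{ then }\mathrm{BRD}(2K)=\eta\}$. Convention: if $j>W_K$ (no $j$-th equilibrium exists), $|\mathrm{BoA}_K(\eta_j)|$ is taken to be $0$. *)

theory Defs
  imports Complex_Main "HOL-Library.FuncSet"
begin

text \<open>Profiles are pairs (a,b) with a, b in {1..K}.  Potentials are bijections
  [K] x [K] -> [K^2], taken extensional (value undefined outside the domain) so that
  the set of potentials is finite and has exactly (K^2)! elements.\<close>

definition potentials :: "nat \<Rightarrow> (nat \<times> nat \<Rightarrow> nat) set" where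
  "potentials K = {\<Psi>. \<Psi> \<in> ({1..K} \<times> {1..K}) \<rightarrow>\<^sub>E {1..K^2}
                       \<and> bij_betw \<Psi> ({1..K} \<times> {1..K}) {1..K^2}}"

definition argminA :: "(nat \<times> nat \<Rightarrow> nat) \<Rightarrow> nat \<Rightarrow> nat \<Rightarrow> nat set" where
  "argminA \<Psi> K b = {a \<in> {1..K}. \<forall>a'\<in>{1..K}. \<Psi> (a, b) \<le> \<Psi> (a', b)}"

definition argminB :: "(nat \<times> nat \<Rightarrow> nat) \<Rightarrow> nat \<Rightarrow> nat \<Rightarrow> nat set" where
  "argminB \<Psi> K a = {b \<in> {1..K}. \<forall>b'\<in>{1..K}. \<Psi> (a, b) \<le> \<Psi> (a, b')}"

definition stepA :: "(nat \<times> nat \<Rightarrow> nat) \<Rightarrow> nat \<Rightarrow> nat \<times> nat \<Rightarrow> nat \<times> nat" where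
  "stepA \<Psi> K p = (let (a', b') = p; S = argminA \<Psi> K b' - {a'} in
      if S \<noteq> {} then (THE a''. a'' \<in> S, b') else p)"

definition stepB :: "(nat \<times> nat \<Rightarrow> nat) \<Rightarrow> nat \<Rightarrow> nat \<times> nat \<Rightarrow> nat \<times> nat" where
  "stepB \<Psi> K p = (let (a', b') = p; S = argminB \<Psi> K a' - {b'} in
      if S \<noteq> {} then (a', THE b''. b'' \<in> S) else p)"

fun brd :: "(nat \<times> nat \<Rightarrow> nat) \<Rightarrow> nat \<Rightarrow> nat \<times> nat \<Rightarrow> nat \<Rightarrow> nat \<times> nat" where
  "brd \<Psi> K p0 0 = p0"
| "brd \<Psi> K p0 (Suc t) =
     (if even t then stepA \<Psi> K (brd \<Psi> K p0 t) else stepB \<Psi> K (brd \<Psi> K p0 t))"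

definition PNE :: "(nat \<times> nat \<Rightarrow> nat) \<Rightarrow> nat \<Rightarrow> (nat \<times> nat) set" where
  "PNE \<Psi> K = {(a, b). a \<in> {1..K} \<and> b \<in> {1..K}
       \<and> (\<forall>a'\<in>{1..K}. \<Psi> (a, b) \<le> \<Psi> (a', b))
       \<and> (\<forall>b'\<in>{1..K}. \<Psi> (a, b) \<le> \<Psi> (a, b'))}"

definition numPNE :: "(nat \<times> nat \<Rightarrow> nat) \<Rightarrow> nat \<Rightarrow> nat" where
  "numPNE \<Psi> K = card (PNE \<Psi> K)"

definition eta :: "(nat \<times> nat \<Rightarrow> nat) \<Rightarrow> nat \<Rightarrow> nat \<Rightarrow> nat \<times> nat" where
  "eta \<Psi> K j = (THE p. p \<in> PNE \<Psi> K \<and> card {q \<in> PNE \<Psi> K. \<Psi> q \<le> \<Psi> p} = j)"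

definition BoA :: "(nat \<times> nat \<Rightarrow> nat) \<Rightarrow> nat \<Rightarrow> nat \<times> nat \<Rightarrow> (nat \<times> nat) set" where
  "BoA \<Psi> K \<eta> = {p \<in> {1..K} \<times> {1..K}. brd \<Psi> K p (2 * K) = \<eta>}"

text \<open>|BoA_K(eta_j)|, with the convention that it is 0 if eta_j does not exist
  (j > W_K; also j = 0).\<close>
definition boa_size :: "(nat \<times> nat \<Rightarrow> nat) \<Rightarrow> nat \<Rightarrow> nat \<Rightarrow> nat" where
  "boa_size \<Psi> K j = (if 1 \<le> j \<and> j \<le> numPNE \<Psi> K then card (BoA \<Psi> K (eta \<Psi> K j)) else 0)"

definition expect_pot :: "nat \<Rightarrow> ((nat \<times> nat \<Rightarrow> nat) \<Rightarrow> real) \<Rightarrow> real" where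
  "expect_pot K f = (\<Sum>\<Psi>\<in>potentials K. f \<Psi>) / real (card (potentials K))"

end

theory Submission
  imports Defs "HOL-Combinatorics.Multiset_Permutations" "HOL-Analysis.Uniform_Limit"
begin

text \<open>The first step forgets the row of the starting profile, so
  \<open>|BoA(\<eta>\<^sub>j)| / K\<close> is the number of columns whose best-response path ends in \<open>\<eta>\<^sub>j\<close>.  Reveal the
  cells in increasing order of potential.  A cell in a new row and a new column is an equilibrium; a cell
  in one new line attaches that line to the component of the line that was already met.  At the birth of
  \<open>\<eta>\<^sub>j\<close>, with \<open>u\<close> rows and \<open>v\<close> columns unmet, the expected final size of its component is an
  explicit sum over path lengths, which tends to \<open>exp x\<close> if \<open>u / K\<close> and \<open>v / K\<close> tend to \<open>x\<close>.
  The number of equilibria met plus \<open>u v / (2 K - 1)\<close> is a martingale and \<open>u - v\<close> drifts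
  towards 0; hence at the birth of \<open>\<eta>\<^sub>j\<close> both \<open>u / K\<close> and \<open>v / K\<close> are close to
  \<open>x = sqrt (1 - 2 j / K)\<close>.  A quadratic superharmonic function turns this into one induction
  on the number of unrevealed cells.\<close>

section \<open>Best-response dynamics and the order of the cells\<close>

text \<open>The component \<open>j\<close> is the set of rows and columns whose best-response path ends in \<open>\<eta>\<^sub>j\<close>.
  A state \<open>(A, B, n, r, c)\<close> holds the rows and the columns met so far, the number of equilibria
  met so far, and the rows and the columns met so far that belong to component \<open>j\<close>.\<close>

type_synonym state = "nat set \<times> nat set \<times> nat \<times> nat set \<times> nat set"

text \<open>A cell with exactly one new line is the minimum of that line, which therefore inherits
  its membership from the old line. If both lines are new, the cell is equilibrium number
  \<open>Suc n\<close>, hence the test \<open>Suc n = j\<close>.\<close>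

fun reveal :: "nat \<Rightarrow> nat \<times> nat \<Rightarrow> state \<Rightarrow> state" where
  "reveal j (a, b) (A, B, n, r, c) =
     (insert a A, insert b B, if a \<notin> A \<and> b \<notin> B then Suc n else n,
      if a \<notin> A \<and> (if b \<in> B then b \<in> c else Suc n = j) then insert a r else r,
      if b \<notin> B \<and> (if a \<in> A then a \<in> r else Suc n = j) then insert b c else c)"

definition explore :: "nat \<Rightarrow> (nat \<times> nat) list \<Rightarrow> state" where
  "explore j xs = fold (reveal j) xs ({}, {}, 0, {}, {})"

definition component_cols :: "state \<Rightarrow> nat set" where
  "component_cols s = snd (snd (snd (snd s)))"

lemma funpow_split: "s \<le> t \<Longrightarrow> (f ^^ t) x = (f ^^ (t - s)) ((f ^^ s) x)"
  by (metis comp_apply funpow_add le_add_diff_inverse2)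

section \<open>Best-response maps of a fixed potential and absorption of the dynamics\<close>

locale potential_game =
  fixes \<Psi> :: "nat \<times> nat \<Rightarrow> nat" and K :: nat
  assumes pot: "\<Psi> \<in> potentials K" and K_pos: "K \<ge> 1"
begin

definition best_row :: "nat \<Rightarrow> nat" where "best_row b = (THE a. a \<in> argminA \<Psi> K b)"
definition best_col :: "nat \<Rightarrow> nat" where "best_col a = (THE b. b \<in> argminB \<Psi> K a)"
text \<open>One round of the dynamics, a row move followed by a column move, acts on the column
  alone by this map.\<close>

definition next_col :: "nat \<Rightarrow> nat" where "next_col b = best_col (best_row b)"

lemma bij: "bij_betw \<Psi> ({1..K} \<times> {1..K}) {1..K^2}"
  using pot by (simp add: potentials_def)

lemma \<Psi>_inj:
  "\<Psi> (a, b) = \<Psi> (a', b') \<Longrightarrow> a \<in> {1..K} \<Longrightarrow> b \<in> {1..K} \<Longrightarrow> a' \<in> {1..K} \<Longrightarrow> b' \<in> {1..K}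
    \<Longrightarrow> a = a' \<and> b = b'"
  using bij unfolding bij_betw_def inj_on_def by (metis SigmaI prod.inject)

lemma argminA_eq: 
  assumes "b \<in> {1..K}"
  shows "argminA \<Psi> K b = {best_row b}"
proof -
  have ne: "{1..K} \<noteq> {}" using K_pos by simp
  obtain a where a: "a \<in> {1..K}" "\<And>a'. a' \<in> {1..K} \<Longrightarrow> \<Psi> (a, b) \<le> \<Psi> (a', b)"
    using ex_min_if_finite[of "(\<lambda>a. \<Psi> (a, b)) ` {1..K}"] ne by (force simp: not_less)
  have "x = a" if "x \<in> {1..K}" "\<forall>a'\<in>{1..K}. \<Psi> (x, b) \<le> \<Psi> (a', b)" for x
    using \<Psi>_inj[of x b a b] a(1) a(2)[OF that(1)] that assms le_antisym by blast
  then have "argminA \<Psi> K b = {a}"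
    using a unfolding argminA_def by blast
  then show ?thesis unfolding best_row_def by simp
qed

lemma argminB_eq: 
  assumes "a \<in> {1..K}"
  shows "argminB \<Psi> K a = {best_col a}"
proof -
  have ne: "{1..K} \<noteq> {}" using K_pos by simp
  obtain b where b: "b \<in> {1..K}" "\<And>b'. b' \<in> {1..K} \<Longrightarrow> \<Psi> (a, b) \<le> \<Psi> (a, b')"
    using ex_min_if_finite[of "(\<lambda>b. \<Psi> (a, b)) ` {1..K}"] ne by (force simp: not_less)
  have "x = b" if "x \<in> {1..K}" "\<forall>b'\<in>{1..K}. \<Psi> (a, x) \<le> \<Psi> (a, b')" for x
    using \<Psi>_inj[of a x a b] b(1) b(2)[OF that(1)] that assms le_antisym by blast
  then have "argminB \<Psi> K a = {b}"
    using b unfolding argminB_def by blast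
  then show ?thesis unfolding best_col_def by simp
qed

lemma best_row_iff:
  assumes "b \<in> {1..K}"
  shows "best_row b = a \<longleftrightarrow> a \<in> {1..K} \<and> (\<forall>a'\<in>{1..K}. \<Psi> (a, b) \<le> \<Psi> (a', b))"
  using arg_cong[OF argminA_eq[OF assms], of "\<lambda>S. a \<in> S"] by (auto simp: argminA_def)

lemma best_col_iff:
  assumes "a \<in> {1..K}"
  shows "best_col a = b \<longleftrightarrow> b \<in> {1..K} \<and> (\<forall>b'\<in>{1..K}. \<Psi> (a, b) \<le> \<Psi> (a, b'))"
  using arg_cong[OF argminB_eq[OF assms], of "\<lambda>S. b \<in> S"] by (auto simp: argminB_def)

lemma best_row_in: "b \<in> {1..K} \<Longrightarrow> best_row b \<in> {1..K}"
  using best_row_iff by blast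

lemma best_col_in: "a \<in> {1..K} \<Longrightarrow> best_col a \<in> {1..K}"
  using best_col_iff by blast

lemma next_col_in: "b \<in> {1..K} \<Longrightarrow> next_col b \<in> {1..K}"
  by (simp only: next_col_def best_row_in best_col_in)

lemma funpow_next_col_in: "b \<in> {1..K} \<Longrightarrow> (next_col ^^ t) b \<in> {1..K}"
  by (induction t) (simp_all only: funpow.simps id_apply comp_apply next_col_in)

lemma PNE_iff:
  "(a, b) \<in> PNE \<Psi> K \<longleftrightarrow> a \<in> {1..K} \<and> b \<in> {1..K} \<and> best_row b = a \<and> best_col a = b"
  using best_row_iff best_col_iff unfolding PNE_def by blast

lemma PNE_subset: "PNE \<Psi> K \<subseteq> {1..K} \<times> {1..K}"
  by (auto simp: PNE_def)

lemma finite_PNE: "finite (PNE \<Psi> K)"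
  by (rule finite_subset[OF PNE_subset]) simp

text \<open>Both branches of the definition agree: if the current row is already the minimiser,
  removing it leaves the empty set and the profile is kept.\<close>

lemma stepA_eq: "b \<in> {1..K} \<Longrightarrow> stepA \<Psi> K (a, b) = (best_row b, b)"
  by (simp add: stepA_def argminA_eq del: atLeastAtMost_iff)

lemma stepB_eq: "a \<in> {1..K} \<Longrightarrow> stepB \<Psi> K (a, b) = (a, best_col a)"
  by (simp add: stepB_def argminB_eq del: atLeastAtMost_iff)

text \<open>The column moves last in a round, so the row belongs to the column one iteration
  earlier. From the first round on, the starting row \<open>a\<close> is forgotten.\<close>

lemma brd_even:
  assumes "b \<in> {1..K}"
  shows "brd \<Psi> K (a, b) (2 * Suc t) = (best_row ((next_col ^^ t) b), (next_col ^^ Suc t) b)"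
proof (induction t)
  case 0
  show ?case using stepA_eq[OF assms] stepB_eq[OF best_row_in[OF assms]]
    by (simp add: numeral_2_eq_2 next_col_def)
next
  case (Suc t)
  have "2 * Suc (Suc t) = Suc (Suc (2 * Suc t))" by simp
  then show ?case
    using stepA_eq[OF funpow_next_col_in[OF assms], of _ "Suc t"]
      stepB_eq[OF best_row_in[OF funpow_next_col_in[OF assms]], of "Suc t"]
    by (simp only: brd.simps Suc.IH) (simp add: next_col_def[of "next_col ((next_col ^^ t) b)"])
qed

text \<open>The minimum of column \<open>next_col b\<close> is at most its entry in row
  \<open>best_row b\<close>, which is the minimum of that row and so at most the minimum of column
  \<open>b\<close>. Equality would force the same cell by injectivity.\<close>

lemma next_col_decr:
  assumes b: "b \<in> {1..K}" and "next_col b \<noteq> b"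
  shows "\<Psi> (best_row (next_col b), next_col b) < \<Psi> (best_row b, b)"
proof -
  have "\<Psi> (best_row (next_col b), next_col b) \<le> \<Psi> (best_row b, next_col b)"
    using best_row_iff[OF next_col_in[OF b]] best_row_in[OF b] by blast
  also have "\<dots> \<le> \<Psi> (best_row b, b)"
    using best_col_iff[OF best_row_in[OF b]] b unfolding next_col_def by blast
  finally have le: "\<Psi> (best_row (next_col b), next_col b) \<le> \<Psi> (best_row b, b)" .
  have "\<Psi> (best_row (next_col b), next_col b) \<noteq> \<Psi> (best_row b, b)"
    using \<Psi>_inj assms best_row_in next_col_in by blast
  with le show ?thesis by simp
qed

lemma next_col_funpow_fixed: "next_col x = x \<Longrightarrow> (next_col ^^ n) x = x"
  by (induction n) auto

text \<open>Pigeonhole: if iterate \<open>K - 1\<close> moves, no earlier iterate is fixed, so the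
  column minima decrease strictly along \<open>K + 1\<close> iterates, which are then distinct
  elements of a set of size \<open>K\<close>.\<close>

lemma next_col_absorbed:
  assumes b: "b \<in> {1..K}" 
  shows "next_col ((next_col ^^ (K - 1)) b) = (next_col ^^ (K - 1)) b"
proof (rule ccontr)
  let ?g = "next_col"
  let ?\<phi> = "\<lambda>t. \<Psi> (best_row ((?g ^^ t) b), (?g ^^ t) b)"
  assume ne: "?g ((?g ^^ (K - 1)) b) \<noteq> (?g ^^ (K - 1)) b"
  have nfix: "?g ((?g ^^ t) b) \<noteq> (?g ^^ t) b" if "t < K" for t
  proof
    assume eq: "?g ((?g ^^ t) b) = (?g ^^ t) b"
    have "(?g ^^ (K - 1)) b = (?g ^^ (K - 1 - t)) ((?g ^^ t) b)"
      using that by (intro funpow_split) simp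
    then have "(?g ^^ (K - 1)) b = (?g ^^ t) b" using next_col_funpow_fixed[OF eq] by simp
    with eq ne show False by simp
  qed
  have dec: "?\<phi> (Suc t) < ?\<phi> t" if "t < K" for t
    using next_col_decr[OF funpow_next_col_in[OF b] nfix[OF that]] by simp
  have "?\<phi> t < ?\<phi> s" if "s < t" "t \<le> K" for s t
    using that
  proof (induction t)
    case (Suc t)
    then show ?case using dec[of t] by (cases "s = t") (auto intro: less_trans)
  qed simp
  then have inj: "inj_on (\<lambda>t. (?g ^^ t) b) {0..K}"
    by (intro inj_onI) (metis atLeastAtMost_iff less_irrefl linorder_neqE_nat)
  have "(\<lambda>t. (?g ^^ t) b) ` {0..K} \<subseteq> {1..K}"
    using funpow_next_col_in[OF b] by blast
  then have "card {0..K} \<le> card {1..K}"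
    by (intro card_inj_on_le[OF inj]) simp_all
  then show False by simp
qed

text \<open>After \<open>K\<close> rounds the path rests at a fixed column \<open>z\<close>. The
  column of an equilibrium is fixed too, so meeting it at any time, before or after absorption, is
  the same as ending there.\<close>

lemma brd_eq_PNE_iff:
  assumes b: "b \<in> {1..K}" and pne: "(a', b') \<in> PNE \<Psi> K"
  shows "brd \<Psi> K (a, b) (2 * K) = (a', b') \<longleftrightarrow> (\<exists>t. (next_col ^^ t) b = b')"
proof -
  let ?g = "next_col"
  define z where "z = (?g ^^ (K - 1)) b"
  have gz: "?g z = z" using next_col_absorbed[OF b] by (simp add: z_def)
  have gK: "(?g ^^ K) b = z"
    using gz K_pos funpow.simps(2)[of "K - 1" ?g] by (simp add: z_def)
  have brd: "brd \<Psi> K (a, b) (2 * K) = (best_row z, z)"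
    using brd_even[OF b, of a "K - 1"] K_pos gK by (simp add: z_def)
  have fix': "?g b' = b'" "best_row b' = a'"
    using pne unfolding PNE_iff next_col_def by auto
  have "z = b'" if t: "(?g ^^ t) b = b'" for t
  proof (cases "t \<le> K - 1")
    case True
    have "z = (?g ^^ (K - 1 - t)) ((?g ^^ t) b)"
      unfolding z_def using True by (rule funpow_split)
    then show ?thesis using t next_col_funpow_fixed[OF fix'(1)] by simp
  next
    case False
    have "(?g ^^ t) b = (?g ^^ (t - (K - 1))) z"
      unfolding z_def using False by (intro funpow_split) simp
    then show ?thesis using t next_col_funpow_fixed[OF gz] by simp
  qed
  then show ?thesis using brd fix' by (auto simp: z_def)
qed

section \<open>Numbering of the equilibria and membership of columns in components\<close>

definition rank :: "nat \<times> nat \<Rightarrow> nat" where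
  "rank p = card {q \<in> PNE \<Psi> K. \<Psi> q \<le> \<Psi> p}"

text \<open>The sets counted by \<open>rank\<close> are nested, so equal cardinalities force equal
  sets, and then equal potentials.\<close>

lemma rank_inj:
  assumes "p \<in> PNE \<Psi> K" "q \<in> PNE \<Psi> K" "rank p = rank q"
  shows "p = q"
proof -
  have *: "p = q" if "p \<in> PNE \<Psi> K" "q \<in> PNE \<Psi> K" "rank p = rank q" "\<Psi> p \<le> \<Psi> q" for p q
  proof -
    have "{r \<in> PNE \<Psi> K. \<Psi> r \<le> \<Psi> p} = {r \<in> PNE \<Psi> K. \<Psi> r \<le> \<Psi> q}"
      using that finite_PNE by (intro card_subset_eq) (auto simp: rank_def)
    then have "\<Psi> q \<le> \<Psi> p" using that by blast
    then have "\<Psi> p = \<Psi> q" using that by simp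
    then show ?thesis using that bij PNE_subset unfolding bij_betw_def inj_on_def by blast
  qed
  show ?thesis using *[of p q] *[of q p] assms by (cases "\<Psi> p \<le> \<Psi> q") auto
qed

lemma rank_range: "rank ` PNE \<Psi> K \<subseteq> {1..numPNE \<Psi> K}"
proof
  fix k assume "k \<in> rank ` PNE \<Psi> K"
  then obtain p where p: "p \<in> PNE \<Psi> K" "k = rank p" by blast
  then have "p \<in> {q \<in> PNE \<Psi> K. \<Psi> q \<le> \<Psi> p}" by simp
  moreover have "finite {q \<in> PNE \<Psi> K. \<Psi> q \<le> \<Psi> p}" using finite_PNE by simp
  ultimately have "0 < rank p" unfolding rank_def card_gt_0_iff by blast
  moreover have "rank p \<le> numPNE \<Psi> K"
    using finite_PNE unfolding rank_def numPNE_def by (intro card_mono) auto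
  ultimately show "k \<in> {1..numPNE \<Psi> K}" using p by simp
qed

text \<open>By counting, the injection \<open>rank\<close> is onto
  \<open>{1..numPNE \<Psi> K}\<close>, so the description behind \<open>THE\<close> in
  \<open>eta\<close> has exactly one solution.\<close>

lemma eta_iff:
  assumes j: "1 \<le> j" "j \<le> numPNE \<Psi> K"
  shows "eta \<Psi> K j = p \<longleftrightarrow> p \<in> PNE \<Psi> K \<and> rank p = j"
proof -
  have "rank ` PNE \<Psi> K = {1..numPNE \<Psi> K}"
  proof (rule card_subset_eq)
    show "rank ` PNE \<Psi> K \<subseteq> {1..numPNE \<Psi> K}"
      by (rule rank_range)
    show "card (rank ` PNE \<Psi> K) = card {1..numPNE \<Psi> K}"
      using rank_inj by (subst card_image) (auto simp: inj_on_def numPNE_def)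
  qed simp
  then have "j \<in> rank ` PNE \<Psi> K" using j by simp
  then obtain q where q: "q \<in> PNE \<Psi> K" "rank q = j" by blast
  have "eta \<Psi> K j = q"
    unfolding eta_def rank_def[symmetric] using q rank_inj by (intro the_equality) auto
  then show ?thesis using q rank_inj by blast
qed

text \<open>The bounds on \<open>j\<close> encode the convention that a missing equilibrium has an
  empty basin; without them \<open>eta\<close> would be an unspecified profile.\<close>

definition in_component :: "nat \<Rightarrow> nat \<Rightarrow> bool" where
  "in_component j b \<longleftrightarrow> 1 \<le> j \<and> j \<le> numPNE \<Psi> K \<and> (\<exists>t. (next_col ^^ t) b = snd (eta \<Psi> K j))"

text \<open>The starting row is irrelevant, so a basin is a union of full columns with
  \<open>K\<close> cells each.\<close>

lemma boa_size_eq: "boa_size \<Psi> K j = K * card {b \<in> {1..K}. in_component j b}"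
proof (cases "1 \<le> j \<and> j \<le> numPNE \<Psi> K")
  case True
  obtain a' b' where e: "eta \<Psi> K j = (a', b')" by fastforce
  have pne: "(a', b') \<in> PNE \<Psi> K" using eta_iff True e by blast
  have "BoA \<Psi> K (eta \<Psi> K j) = {1..K} \<times> {b \<in> {1..K}. in_component j b}"
    unfolding BoA_def using brd_eq_PNE_iff[OF _ pne] True by (auto simp: e in_component_def)
  then show ?thesis using True by (simp add: boa_size_def card_cartesian_product)
next
  case False
  then show ?thesis by (auto simp: boa_size_def in_component_def)
qed

text \<open>The column of an equilibrium is fixed by \<open>next_col\<close>, so its path reaches no
  other equilibrium.\<close>

lemma in_component_PNE:
  assumes pne: "(a, b) \<in> PNE \<Psi> K"
  shows "in_component j b \<longleftrightarrow> rank (a, b) = j"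
proof -
  have g: "(next_col ^^ t) b = b" for t
    using pne by (intro next_col_funpow_fixed) (auto simp: PNE_iff next_col_def)
  have "rank (a, b) \<in> {1..numPNE \<Psi> K}"
    using rank_range pne by blast
  moreover have "snd (eta \<Psi> K j) = b \<longleftrightarrow> rank (a, b) = j" if "1 \<le> j" "j \<le> numPNE \<Psi> K"
  proof -
    obtain a' b' where e: "eta \<Psi> K j = (a', b')" by fastforce
    have "(a', b') \<in> PNE \<Psi> K" "rank (a', b') = j" using eta_iff that e by blast+
    then show ?thesis using e eta_iff[OF that, of "(a, b)"] pne by (auto simp: PNE_iff)
  qed
  ultimately show ?thesis by (auto simp: in_component_def g)
qed

text \<open>If the minimum of column \<open>b\<close> is not an equilibrium, then \<open>b\<close>
  is not the column of any \<open>eta\<close>, so a path from \<open>b\<close> that hits such a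
  column makes at least one move.\<close>

lemma in_component_step:
  assumes "b \<in> {1..K}" "(best_row b, b) \<notin> PNE \<Psi> K"
  shows "in_component j b \<longleftrightarrow> in_component j (next_col b)"
proof -
  have "b \<noteq> snd (eta \<Psi> K j)" if "1 \<le> j" "j \<le> numPNE \<Psi> K"
  proof
    assume b: "b = snd (eta \<Psi> K j)"
    obtain a' b' where e: "eta \<Psi> K j = (a', b')" by fastforce
    have "(a', b') \<in> PNE \<Psi> K" using eta_iff that e by blast
    then show False using b e assms by (auto simp: PNE_iff)
  qed
  then have "(\<exists>t. (next_col ^^ t) b = snd (eta \<Psi> K j)) \<longleftrightarrow>
    (\<exists>t. (next_col ^^ t) (next_col b) = snd (eta \<Psi> K j))" if "1 \<le> j" "j \<le> numPNE \<Psi> K"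
    using that by (metis comp_apply funpow_Suc_right funpow_0 not0_implies_Suc)
  then show ?thesis unfolding in_component_def by blast
qed

section \<open>The exploration driven by the order of the potential\<close>

definition cells :: "nat \<Rightarrow> (nat \<times> nat) set" where
  "cells m = {e \<in> {1..K} \<times> {1..K}. \<Psi> e \<le> m}"

text \<open>The value that the exploration is to have once the potentials up to \<open>m\<close> are
  revealed, expressed by the dynamics. The path of a row goes on in its best column, which decides
  the membership of the row.\<close>

definition state_at :: "nat \<Rightarrow> nat \<Rightarrow> state" where
  "state_at j m = (fst ` cells m, snd ` cells m, card (PNE \<Psi> K \<inter> cells m),
     {a \<in> fst ` cells m. in_component j (best_col a)}, {b \<in> snd ` cells m. in_component j b})"

text \<open>Whether the row and the column of the next cell are new decides whether the cell is the
  minimum of the row and of the column. This matches the cases of \<open>reveal\<close> with the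
  steps of the dynamics; with both lines new the cell is an equilibrium whose rank is one more than
  the number met so far.\<close>

lemma state_at_Suc:
  assumes ab: "a \<in> {1..K}" "b \<in> {1..K}" and m: "\<Psi> (a, b) = Suc m"
  shows "reveal j (a, b) (state_at j m) = state_at j (Suc m)"
proof -
  have ins: "cells (Suc m) = insert (a, b) (cells m)"
  proof -
    have "x = (a, b)" if "x \<in> {1..K} \<times> {1..K}" "\<Psi> x = Suc m" for x
      using that m ab \<Psi>_inj[of "fst x" "snd x" a b] by (cases x) auto
    then show ?thesis using ab m by (auto simp: cells_def le_Suc_eq simp del: atLeastAtMost_iff)
  qed
  \<comment> \<open>A row is unmet exactly if all its cells have potential at least
    \<open>Suc m\<close>, that is, if the present cell is its minimum.\<close>
  have A: "a \<notin> fst ` cells m \<longleftrightarrow> best_col a = b"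
  proof -
    have "a \<notin> fst ` cells m \<longleftrightarrow> (\<forall>b'\<in>{1..K}. Suc m \<le> \<Psi> (a, b'))"
      using ab by (force simp: cells_def image_iff simp del: atLeastAtMost_iff)
    then show ?thesis using best_col_iff[of a b] ab m by auto
  qed
  have B: "b \<notin> snd ` cells m \<longleftrightarrow> best_row b = a"
  proof -
    have "b \<notin> snd ` cells m \<longleftrightarrow> (\<forall>a'\<in>{1..K}. Suc m \<le> \<Psi> (a', b))"
      using ab by (force simp: cells_def image_iff simp del: atLeastAtMost_iff)
    then show ?thesis using best_row_iff[of b a] ab m by auto
  qed
  have ncell: "(a, b) \<notin> cells m" using m by (auto simp: cells_def)
  have fin: "finite (cells m)" by (auto simp: cells_def)
  show ?thesis
  proof (cases "a \<in> fst ` cells m"; cases "b \<in> snd ` cells m")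
    assume old: "a \<in> fst ` cells m" "b \<in> snd ` cells m"
    then have "(a, b) \<notin> PNE \<Psi> K" using A B by (auto simp: PNE_iff)
    then show ?thesis using old by (auto simp: state_at_def ins insert_absorb)
  next
    assume old: "a \<in> fst ` cells m" and new: "b \<notin> snd ` cells m"
    then have np: "(a, b) \<notin> PNE \<Psi> K" using A B by (auto simp: PNE_iff)
    have "in_component j b \<longleftrightarrow> in_component j (best_col a)"
      using in_component_step[of b j] ab np B new by (auto simp: next_col_def)
    then show ?thesis using old new np by (auto simp: state_at_def ins insert_absorb)
  next
    assume new: "a \<notin> fst ` cells m" and old: "b \<in> snd ` cells m"
    then have np: "(a, b) \<notin> PNE \<Psi> K" using A B by (auto simp: PNE_iff)
    have "best_col a = b" using A new by blast
    then show ?thesis using old new np by (auto simp: state_at_def ins insert_absorb)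
  next
    assume new: "a \<notin> fst ` cells m" "b \<notin> snd ` cells m"
    then have p: "(a, b) \<in> PNE \<Psi> K" and "best_col a = b" using A B ab by (auto simp: PNE_iff)
    have "{q \<in> PNE \<Psi> K. \<Psi> q \<le> \<Psi> (a, b)} = PNE \<Psi> K \<inter> cells (Suc m)"
      using PNE_subset m by (auto simp: cells_def)
    then have "rank (a, b) = Suc (card (PNE \<Psi> K \<inter> cells m))"
      using p ncell fin by (simp add: rank_def ins)
    then show ?thesis using in_component_PNE[OF p, of j] p ncell fin new \<open>best_col a = b\<close>
      by (auto simp: state_at_def ins)
  qed
qed

definition cell_order :: "(nat \<times> nat) list" where
  "cell_order = map (\<lambda>i. inv_into ({1..K} \<times> {1..K}) \<Psi> (Suc i)) [0..<K^2]"

lemma component_cols_cell_order: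
  "component_cols (explore j cell_order) = {b \<in> {1..K}. in_component j b}"
proof -
  \<comment> \<open>Prefixes of the order are followed up to the full length \<open>K^2\<close>,
    where all columns are met.\<close>
  have "explore j (take m cell_order) = state_at j m" if "m \<le> K^2" for m
    using that
  proof (induction m)
    case 0
    have "cells 0 = {}"
      using bij unfolding cells_def bij_betw_def by force
    then show ?case by (simp add: explore_def state_at_def)
  next
    case (Suc m)
    let ?e = "inv_into ({1..K} \<times> {1..K}) \<Psi> (Suc m)"
    have "Suc m \<in> \<Psi> ` ({1..K} \<times> {1..K})" using bij Suc.prems by (auto simp: bij_betw_def)
    then have e: "?e \<in> {1..K} \<times> {1..K}" "\<Psi> ?e = Suc m"
      by (rule inv_into_into, rule f_inv_into_f)
    have "take (Suc m) cell_order = take m cell_order @ [?e]"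
      using Suc.prems by (simp add: take_Suc_conv_app_nth cell_order_def)
    then have "explore j (take (Suc m) cell_order) = reveal j ?e (state_at j m)"
      using Suc by (simp add: explore_def)
    also have "\<dots> = state_at j (Suc m)"
      using e by (cases ?e) (auto intro!: state_at_Suc simp del: reveal.simps)
    finally show ?case .
  qed
  from this[of "K^2"] have "explore j cell_order = state_at j (K^2)"
    by (simp add: cell_order_def)
  moreover have "cells (K^2) = {1..K} \<times> {1..K}"
    using bij unfolding cells_def bij_betw_def by auto
  then have "snd ` cells (K^2) = {1..K}" using K_pos by force
  ultimately show ?thesis by (simp add: component_cols_def state_at_def)
qed

lemma boa_size_explore: "boa_size \<Psi> K j = K * card (component_cols (explore j cell_order))"
  by (simp only: boa_size_eq component_cols_cell_order)

end

section \<open>Uniform potentials as uniform orders of the cells\<close>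

lemma bij_betw_cell_order:
  assumes "K \<ge> 1"
  shows "bij_betw (\<lambda>\<Psi>. potential_game.cell_order \<Psi> K) (potentials K)
    (permutations_of_set ({1..K} \<times> {1..K}))"
proof -
  let ?S = "{1..K} \<times> {1..K}"
  let ?L = "\<lambda>\<Psi>. potential_game.cell_order \<Psi> K"
  \<comment> \<open>The inverse map gives each cell its position in the list plus one;
    \<open>restrict\<close> makes it extensional, as \<open>potentials\<close> demands.\<close>
  define P where "P = (\<lambda>xs. restrict (\<lambda>e. Suc (inv_into {..<K^2} ((!) xs) e)) ?S)"
  have game: "potential_game \<Psi> K" if "\<Psi> \<in> potentials K" for \<Psi>
    using that assms by unfold_locales
  have L: "?L \<Psi> = map (\<lambda>i. inv_into ?S \<Psi> (Suc i)) [0..<K^2]" if "\<Psi> \<in> potentials K" for \<Psi>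
    using potential_game.cell_order_def[OF game[OF that]] .
  have invb: "bij_betw (\<lambda>i. inv_into ?S \<Psi> (Suc i)) {..<K^2} ?S" if "\<Psi> \<in> potentials K" for \<Psi>
  proof -
    have "bij_betw (inv_into ?S \<Psi> \<circ> Suc) {..<K^2} ?S"
      using bij_betw_inv_into[OF potential_game.bij[OF game[OF that]]]
      by (intro bij_betw_trans[of Suc _ "{1..K^2}"]) (auto simp: bij_betw_def image_Suc_lessThan)
    then show ?thesis by (simp add: comp_def)
  qed
  have nthb: "bij_betw ((!) xs) {..<K^2} ?S" if "xs \<in> permutations_of_set ?S" for xs
    using that by (intro bij_betw_nth)
      (auto simp: permutations_of_setD card_cartesian_product power2_eq_square
        dest: length_finite_permutations_of_set)
  have perm: "?L \<Psi> \<in> permutations_of_set ?S" if "\<Psi> \<in> potentials K" for \<Psi>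
    using invb[OF that] unfolding L[OF that] bij_betw_def
    by (intro permutations_of_setI) (auto simp: distinct_map atLeast0LessThan)
  have P_bij: "bij_betw (P xs) ?S {1..K^2}" if "xs \<in> permutations_of_set ?S" for xs
  proof -
    have "bij_betw (Suc \<circ> inv_into {..<K^2} ((!) xs)) ?S {1..K^2}"
      using bij_betw_inv_into[OF nthb[OF that]]
      by (intro bij_betw_trans[of _ _ "{..<K^2}"]) (auto simp: bij_betw_def image_Suc_lessThan)
    then show ?thesis
      unfolding P_def by (subst bij_betw_cong[where g = "Suc \<circ> inv_into {..<K^2} ((!) xs)"]) auto
  qed
  have P_pot: "P xs \<in> potentials K" if "xs \<in> permutations_of_set ?S" for xs
  proof -
    have "P xs \<in> ?S \<rightarrow>\<^sub>E {1..K^2}"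
      using P_bij[OF that] by (intro PiE_I) (auto simp: bij_betw_def P_def)
    then show ?thesis using P_bij[OF that] by (simp add: potentials_def)
  qed
  show ?thesis
  proof (rule bij_betwI[where g = P])
    show "?L \<in> potentials K \<rightarrow> permutations_of_set ?S" using perm by blast
    show "P \<in> permutations_of_set ?S \<rightarrow> potentials K" using P_pot by blast
    show "P (?L \<Psi>) = \<Psi>" if \<Psi>: "\<Psi> \<in> potentials K" for \<Psi>
    proof (rule extensionalityI)
      show "P (?L \<Psi>) \<in> extensional ?S" by (simp add: P_def)
      show "\<Psi> \<in> extensional ?S" using \<Psi> by (auto simp: potentials_def PiE_def)
      fix e assume e: "e \<in> ?S"
      have in1: "\<Psi> e \<in> {1..K^2}" and inv: "inv_into ?S \<Psi> (\<Psi> e) = e"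
        using potential_game.bij[OF game[OF \<Psi>]] e by (auto simp: bij_betw_def)
      have i: "\<Psi> e - 1 \<in> {..<K^2}" and S: "Suc (\<Psi> e - 1) = \<Psi> e" using in1 by auto
      have "?L \<Psi> ! (\<Psi> e - 1) = e"
        using i S inv by (simp add: L[OF \<Psi>])
      then have "inv_into {..<K^2} ((!) (?L \<Psi>)) e = \<Psi> e - 1"
        using nthb[OF perm[OF \<Psi>]] i by (intro inv_into_f_eq) (auto simp: bij_betw_def)
      then show "P (?L \<Psi>) e = \<Psi> e" using e S by (simp add: P_def)
    qed
    show "?L (P xs) = xs" if xs: "xs \<in> permutations_of_set ?S" for xs
    proof (rule nth_equalityI)
      have len: "length xs = K^2"
        using length_finite_permutations_of_set[OF xs]
        by (simp add: card_cartesian_product power2_eq_square)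
      note Pxs = P_pot[OF xs]
      show "length (?L (P xs)) = length xs" by (simp add: L[OF Pxs] len)
      fix i assume "i < length (?L (P xs))"
      then have i: "i < K^2" by (simp add: L[OF Pxs])
      have "xs ! i \<in> ?S" using nthb[OF xs] i by (auto simp: bij_betw_def)
      moreover have "inv_into {..<K^2} ((!) xs) (xs ! i) = i"
        using nthb[OF xs] i by (intro inv_into_f_eq) (auto simp: bij_betw_def)
      ultimately have "inv_into ?S (P xs) (Suc i) = xs ! i"
        using P_bij[OF xs] by (intro inv_into_f_eq) (auto simp: bij_betw_def P_def)
      then show "?L (P xs) ! i = xs ! i" using i by (simp add: L[OF Pxs])
    qed
  qed
qed

section \<open>Superharmonic functions of the exploration\<close>

definition perm_avg :: "'a set \<Rightarrow> ('a list \<Rightarrow> real) \<Rightarrow> real" where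
  "perm_avg S f = (\<Sum>xs\<in>permutations_of_set S. f xs) / fact (card S)"

text \<open>The \<open>K\<close> cells of each column cancel the normalisation, and the bijection
  with orders carries the uniform law over.\<close>

lemma expect_boa_size:
  assumes "K \<ge> 1"
  shows "expect_pot K (\<lambda>\<Psi>. real (boa_size \<Psi> K j) / real K) =
    perm_avg ({1..K} \<times> {1..K}) (\<lambda>xs. real (card (component_cols (explore j xs))))"
proof -
  let ?S = "{1..K} \<times> {1..K}"
  have "potential_game \<Psi> K" if "\<Psi> \<in> potentials K" for \<Psi>
    using that assms by unfold_locales
  then have "real (boa_size \<Psi> K j) / real K =
      real (card (component_cols (explore j (potential_game.cell_order \<Psi> K))))"
    if "\<Psi> \<in> potentials K" for \<Psi>
    using potential_game.boa_size_explore that assms by (simp add: of_nat_mult)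
  moreover have "card (potentials K) = fact (card ?S)"
    using bij_betw_same_card[OF bij_betw_cell_order[OF assms]] by simp
  ultimately show ?thesis
    unfolding expect_pot_def perm_avg_def
    using sum.reindex_bij_betw[OF bij_betw_cell_order[OF assms],
      of "\<lambda>xs. real (card (component_cols (explore j xs)))"] by simp
qed

lemma perm_avg_Nil [simp]: "perm_avg {} f = f []"
  by (simp add: perm_avg_def)

text \<open>Conditioning on the first element of the order.\<close>

lemma perm_avg_rec:
  assumes "finite S" "S \<noteq> {}"
  shows "real (card S) * perm_avg S f = (\<Sum>e\<in>S. perm_avg (S - {e}) (\<lambda>xs. f (e # xs)))"
proof -
  have "(\<Sum>xs\<in>permutations_of_set S. f xs) =
      (\<Sum>e\<in>S. \<Sum>xs\<in>(#) e ` permutations_of_set (S - {e}). f xs)"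
    unfolding permutations_of_set_nonempty[OF assms(2)]
    by (rule sum.UNION_disjoint) (use assms in auto)
  also have "\<dots> = (\<Sum>e\<in>S. \<Sum>xs\<in>permutations_of_set (S - {e}). f (e # xs))"
    by (simp add: sum.reindex)
  also have "\<dots> = (\<Sum>e\<in>S. fact (card S - 1) * perm_avg (S - {e}) (\<lambda>xs. f (e # xs)))"
    using assms by (simp add: perm_avg_def)
  finally have "(\<Sum>xs\<in>permutations_of_set S. f xs) =
    fact (card S - 1) * (\<Sum>e\<in>S. perm_avg (S - {e}) (\<lambda>xs. f (e # xs)))"
    by (simp add: sum_distrib_left)
  moreover have "fact (card S) = real (card S) * fact (card S - 1)"
    using assms by (simp add: fact_reduce card_gt_0_iff)
  ultimately show ?thesis using assms by (simp add: perm_avg_def)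
qed

text \<open>A function whose mean does not grow when a uniformly chosen remaining element is
  revealed bounds the expected final value. The invariant \<open>I\<close> ties the state to the set
  of unrevealed elements.\<close>

lemma perm_avg_superharmonic:
  fixes H val :: "'s \<Rightarrow> real" and step :: "'a \<Rightarrow> 's \<Rightarrow> 's"
  assumes "finite S" "I S s"
    and step_inv: "\<And>S s e. I S s \<Longrightarrow> e \<in> S \<Longrightarrow> I (S - {e}) (step e s)"
    and super: "\<And>S s. finite S \<Longrightarrow> I S s \<Longrightarrow> (\<Sum>e\<in>S. H (step e s)) \<le> card S * H s"
    and final: "\<And>s. I {} s \<Longrightarrow> val s \<le> H s"
  shows "perm_avg S (\<lambda>xs. val (fold step xs s)) \<le> H s"
  using assms(1,2)
proof (induction "card S" arbitrary: S s)
  case 0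
  then show ?case using final by simp
next
  case (Suc m)
  then have ne: "S \<noteq> {}" by auto
  have "real (card S) * perm_avg S (\<lambda>xs. val (fold step xs s)) \<le> (\<Sum>e\<in>S. H (step e s))"
    unfolding perm_avg_rec[OF Suc.prems(1) ne]
  proof (rule sum_mono)
    fix e assume e: "e \<in> S"
    have "perm_avg (S - {e}) (\<lambda>xs. val (fold step xs (step e s))) \<le> H (step e s)"
      using Suc e step_inv by (intro Suc.hyps(1)) auto
    then show "perm_avg (S - {e}) (\<lambda>xs. val (fold step (e # xs) s)) \<le> H (step e s)" by simp
  qed
  also have "\<dots> \<le> card S * H s" using super Suc.prems by blast
  finally show ?case
    by (rule mult_left_le_imp_le) (use Suc.prems(1) ne in \<open>simp add: card_gt_0_iff\<close>)
qed

text \<open>All cells outside \<open>A \<times> B\<close> are unrevealed, since a revealed cell has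
  both lines met. Which cells of \<open>A \<times> B\<close> remain is left open. The last clause
  says that component \<open>j\<close> has no lines before its equilibrium is met.\<close>

fun consistent :: "nat \<Rightarrow> nat \<Rightarrow> (nat \<times> nat) set \<Rightarrow> state \<Rightarrow> bool" where
  "consistent K j S (A, B, n, r, c) \<longleftrightarrow> A \<subseteq> {1..K} \<and> B \<subseteq> {1..K} \<and> r \<subseteq> A \<and> c \<subseteq> B
     \<and> S \<subseteq> {1..K} \<times> {1..K} \<and> {1..K} \<times> {1..K} \<subseteq> S \<union> A \<times> B \<and> (n < j \<longrightarrow> r = {} \<and> c = {})"

lemma consistent_reveal:
  assumes "consistent K j S s" "e \<in> S"
  shows "consistent K j (S - {e}) (reveal j e s)"
proof -
  obtain a b where e: "e = (a, b)" by fastforce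
  obtain A B n r c where s: "s = (A, B, n, r, c)" by (metis prod_cases5)
  have sub: "A \<subseteq> {1..K}" "B \<subseteq> {1..K}" "r \<subseteq> A" "c \<subseteq> B" "S \<subseteq> {1..K} \<times> {1..K}"
    "{1..K} \<times> {1..K} \<subseteq> S \<union> A \<times> B" "n < j \<longrightarrow> r = {} \<and> c = {}"
    using assms(1) unfolding s by simp_all
  have ab: "a \<in> {1..K}" "b \<in> {1..K}" using assms(2) sub(5) unfolding e by blast+
  have "{1..K} \<times> {1..K} \<subseteq> (S - {e}) \<union> insert a A \<times> insert b B"
    using sub(6) unfolding e by blast
  moreover have "S - {e} \<subseteq> {1..K} \<times> {1..K}" using sub(5) by blast
  moreover have "insert a A \<subseteq> {1..K}" "insert b B \<subseteq> {1..K}" using ab sub by blast+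
  ultimately show ?thesis
    using sub(3,4,7) unfolding e s reveal.simps consistent.simps by (auto simp del: atLeastAtMost_iff)
qed

fun state_fun :: "nat \<Rightarrow> (nat \<Rightarrow> nat \<Rightarrow> nat \<Rightarrow> nat \<Rightarrow> nat \<Rightarrow> real) \<Rightarrow> state \<Rightarrow> real" where
  "state_fun K h (A, B, n, r, c) = h (K - card A) (K - card B) n (card r) (card c)"

text \<open>Revealing a cell of \<open>A \<times> B\<close> does not change the state, so only the other three blocks of
  cells contribute to the drift.\<close>

lemma sum_reveal:
  assumes fin: "finite S" and cons: "consistent K j S (A, B, n, r, c)"
  defines "u \<equiv> K - card A" and "v \<equiv> K - card B"
  defines "\<rho> \<equiv> card r" and "\<gamma> \<equiv> card c" and "d \<equiv> of_bool (Suc n = j)"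
  defines "m \<equiv> card (S \<inter> A \<times> B)"
  shows "(\<Sum>e\<in>S. state_fun K h (reveal j e (A, B, n, r, c))) =
      real u * real v * h (u - 1) (v - 1) (Suc n) (\<rho> + d) (\<gamma> + d)
    + real u * (real \<gamma> * h (u - 1) v n (\<rho> + 1) \<gamma> + (real K - real v - real \<gamma>) * h (u - 1) v n \<rho> \<gamma>)
    + real v * (real \<rho> * h u (v - 1) n \<rho> (\<gamma> + 1) + (real K - real u - real \<rho>) * h u (v - 1) n \<rho> \<gamma>)
    + real m * h u v n \<rho> \<gamma>" (is "?sum = _")
    and "real (card S) = real u * real v + real u * (real K - real v) + real v * (real K - real u) + real m"
proof -
  let ?I = "{1..K}" and ?s = "(A, B, n, r, c)"
  let ?f = "\<lambda>e. state_fun K h (reveal j e ?s)"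
  let ?A = "?I - A" and ?B = "?I - B"
  have sub: "A \<subseteq> ?I" "B \<subseteq> ?I" "r \<subseteq> A" "c \<subseteq> B" "S \<subseteq> ?I \<times> ?I" "?I \<times> ?I \<subseteq> S \<union> A \<times> B"
    using cons by auto
  have finAB: "finite A" "finite B" "finite r" "finite c"
    using sub finite_subset[OF _ finite_atLeastAtMost] by (meson order_trans)+
  have cA: "card A \<le> K" "card B \<le> K" using sub card_mono[of ?I] by fastforce+
  have card: "card ?A = u" "card ?B = v"
    using sub finAB by (simp_all add: card_Diff_subset u_def v_def)
  have le: "\<rho> \<le> card A" "\<gamma> \<le> card B"
    unfolding \<rho>_def \<gamma>_def using sub finAB by (simp_all add: card_mono)
  \<comment> \<open>A block that involves an unmet line has lost no cell, so only the last block is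
    cut by \<open>S\<close>.\<close>
  have S: "S = (?A \<times> ?B \<union> ?A \<times> B) \<union> (A \<times> ?B \<union> S \<inter> A \<times> B)" using sub by blast
  have fS: "finite (?A \<times> ?B)" "finite (?A \<times> B)" "finite (A \<times> ?B)" "finite (S \<inter> A \<times> B)"
    using finAB by auto
  have split: "sum g S = sum g (?A \<times> ?B) + sum g (?A \<times> B) + sum g (A \<times> ?B) + sum g (S \<inter> A \<times> B)"
    for g :: "nat \<times> nat \<Rightarrow> real"
    by (subst S, subst sum.union_disjoint, use fS in simp, use fS in simp, blast,
        subst sum.union_disjoint, use fS in simp, use fS in simp, blast,
        subst sum.union_disjoint, use fS in simp, use fS in simp, blast) simp
  have u1: "K - Suc (card A) = u - 1" "K - Suc (card B) = v - 1" by (simp_all add: u_def v_def)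
  have nr: "a \<notin> r" if "a \<in> ?A" for a using that sub by blast
  have nc: "b \<notin> c" if "b \<in> ?B" for b using that sub by blast
  have s1: "sum ?f (?A \<times> ?B) = (\<Sum>e\<in>?A \<times> ?B. h (u - 1) (v - 1) (Suc n) (\<rho> + d) (\<gamma> + d))"
    using finAB u1 nr nc by (intro sum.cong refl) (auto simp: \<rho>_def \<gamma>_def d_def)
  \<comment> \<open>A new row met in an old column follows that column, hence enters the component
    exactly for \<open>b \<in> c\<close>.\<close>
  have s2: "sum ?f (?A \<times> B) = (\<Sum>a\<in>?A. \<Sum>b\<in>B. if b \<in> c then h (u - 1) v n (\<rho> + 1) \<gamma> else h (u - 1) v n \<rho> \<gamma>)"
    unfolding sum.cartesian_product using finAB u1 nr
    by (intro sum.cong refl) (auto simp: \<rho>_def \<gamma>_def insert_absorb v_def)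
  have s3: "sum ?f (A \<times> ?B) = (\<Sum>a\<in>A. \<Sum>b\<in>?B. if a \<in> r then h u (v - 1) n \<rho> (\<gamma> + 1) else h u (v - 1) n \<rho> \<gamma>)"
    unfolding sum.cartesian_product using finAB u1 nc
    by (intro sum.cong refl) (auto simp: \<rho>_def \<gamma>_def insert_absorb u_def)
  have s4: "sum ?f (S \<inter> A \<times> B) = (\<Sum>e\<in>S \<inter> A \<times> B. h u v n \<rho> \<gamma>)"
    by (intro sum.cong refl) (auto simp: \<rho>_def \<gamma>_def insert_absorb u_def v_def)
  have if_sum: "(\<Sum>x\<in>X. if x \<in> Y then p else q) = real (card Y) * p + (real (card X) - real (card Y)) * q"
    if "finite X" "Y \<subseteq> X" for X Y :: "nat set" and p q :: real
  proof -
    have "X \<inter> {x. x \<in> Y} = Y" "X \<inter> - {x. x \<in> Y} = X - Y" using that by auto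
    moreover have "real (card (X - Y)) = real (card X) - real (card Y)"
      using that by (simp add: card_Diff_subset finite_subset card_mono of_nat_diff)
    ultimately show ?thesis using that(1) by (subst sum.If_cases) simp_all
  qed
  have cr: "real (card A) = real K - real u" "real (card B) = real K - real v"
    using cA by (simp_all add: u_def v_def of_nat_diff)
  show "?sum = real u * real v * h (u - 1) (v - 1) (Suc n) (\<rho> + d) (\<gamma> + d)
    + real u * (real \<gamma> * h (u - 1) v n (\<rho> + 1) \<gamma> + (real K - real v - real \<gamma>) * h (u - 1) v n \<rho> \<gamma>)
    + real v * (real \<rho> * h u (v - 1) n \<rho> (\<gamma> + 1) + (real K - real u - real \<rho>) * h u (v - 1) n \<rho> \<gamma>)
    + real m * h u v n \<rho> \<gamma>"
    unfolding split s1 s2 s3 s4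
    using sub finAB card cr
    by (subst sum.swap[of _ _ A]) (simp add: if_sum card_cartesian_product m_def \<rho>_def \<gamma>_def)
  have "real (card S) = (\<Sum>e\<in>S. 1)" by simp
  also have "\<dots> = real u * real v + real u * (real K - real v) + real v * (real K - real u) + real m"
    unfolding split using card cr by (simp add: card_cartesian_product m_def)
  finally show "real (card S) = \<dots>" .
qed

text \<open>The remaining cells of \<open>A \<times> B\<close> contribute the same amount to both
  sides and cancel. What is left is a condition on the five counts alone, weighted by the cells in
  at least one unmet line.\<close>

lemma explore_superharmonic:
  fixes h :: "nat \<Rightarrow> nat \<Rightarrow> nat \<Rightarrow> nat \<Rightarrow> nat \<Rightarrow> real" and val :: "nat \<Rightarrow> real"
  assumes super: "\<And>u v n \<rho> \<gamma> d. u \<le> K \<Longrightarrow> v \<le> K \<Longrightarrow> (n < j \<longrightarrow> \<rho> = 0 \<and> \<gamma> = 0) \<Longrightarrow> d = of_bool (Suc n = j) \<Longrightarrow>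
      real u * real v * h (u - 1) (v - 1) (Suc n) (\<rho> + d) (\<gamma> + d)
    + real u * (real \<gamma> * h (u - 1) v n (\<rho> + 1) \<gamma> + (real K - real v - real \<gamma>) * h (u - 1) v n \<rho> \<gamma>)
    + real v * (real \<rho> * h u (v - 1) n \<rho> (\<gamma> + 1) + (real K - real u - real \<rho>) * h u (v - 1) n \<rho> \<gamma>)
    \<le> (real u * real v + real u * (real K - real v) + real v * (real K - real u)) * h u v n \<rho> \<gamma>"
    and final: "\<And>n \<rho> \<gamma>. (n < j \<longrightarrow> \<rho> = 0 \<and> \<gamma> = 0) \<Longrightarrow> val \<gamma> \<le> h 0 0 n \<rho> \<gamma>"
    and K: "K \<ge> 1"
  shows "perm_avg ({1..K} \<times> {1..K}) (\<lambda>xs. val (card (component_cols (explore j xs)))) \<le> h K K 0 0 0"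
proof -
  have "perm_avg ({1..K} \<times> {1..K})
      (\<lambda>xs. (\<lambda>s. val (card (component_cols s))) (fold (reveal j) xs ({}, {}, 0, {}, {})))
    \<le> state_fun K h ({}, {}, 0, {}, {})"
  proof (rule perm_avg_superharmonic[where I = "consistent K j"])
    fix S s assume fin: "finite S" and cons: "consistent K j S s"
    obtain A B n r c where s: "s = (A, B, n, r, c)" by (metis prod_cases5)
    have "n < j \<longrightarrow> card r = 0 \<and> card c = 0" using cons s by auto
    from super[OF _ _ this refl, of "K - card A" "K - card B"]
    show "(\<Sum>e\<in>S. state_fun K h (reveal j e s)) \<le> real (card S) * state_fun K h s"
      unfolding s sum_reveal[OF fin cons[unfolded s]] state_fun.simps
      unfolding distrib_right[of _ "real (card (S \<inter> A \<times> B))"] by simp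
  next
    fix s assume cons: "consistent K j {} s"
    obtain A B n r c where s: "s = (A, B, n, r, c)" by (metis prod_cases5)
    have "A = {1..K}" "B = {1..K}" using cons K unfolding s by auto
    moreover have "n < j \<longrightarrow> card r = 0 \<and> card c = 0" using cons s by auto
    ultimately show "val (card (component_cols s)) \<le> state_fun K h s"
      using final[of n "card r" "card c"] by (simp add: s component_cols_def)
  qed (auto simp del: reveal.simps intro: consistent_reveal)
  then show ?thesis by (simp add: explore_def)
qed

section \<open>Expected component sizes\<close>

text \<open>The falling factorial at a real argument: at 0 the shift \<open>u - 1\<close> is then
  not truncated, so that the drift equations become polynomial identities.\<close>

definition ffact :: "real \<Rightarrow> nat \<Rightarrow> real" where
  "ffact x n = (\<Prod>i<n. x - real i)"

text \<open>The number of cells in the union of \<open>i div 2\<close> rows and \<open>(i + 1) div 2\<close> columns.\<close>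

definition cross_size :: "nat \<Rightarrow> nat \<Rightarrow> real" where
  "cross_size K i = real i * real K - real (i div 2) * real ((i + 1) div 2)"

text \<open>With \<open>u\<close> rows and \<open>v\<close> columns still unmet, \<open>paths K l u v\<close> is the expected number of
  best-response paths that start in an unmet column and reach a given line, a column for even \<open>l\<close> and a
  row for odd \<open>l\<close>, after \<open>l\<close> steps.  The cell by which a line points towards the given one has to
  be the smallest cell of that line and of all lines farther out; \<open>i\<close> such lines have
  \<open>cross_size K i\<close> cells.\<close>

definition paths :: "nat \<Rightarrow> nat \<Rightarrow> real \<Rightarrow> real \<Rightarrow> real" where
  "paths K l u v = ffact u (l div 2) * ffact v ((l + 1) div 2) / (\<Prod>i=1..l. cross_size K i)"

text \<open>What one row of the component, and in \<open>col_weight\<close> one column, adds on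
  average to the final number of columns; length 0 counts the column itself. Longer paths would need
  more than \<open>K\<close> unmet columns.\<close>

definition row_weight :: "nat \<Rightarrow> real \<Rightarrow> real \<Rightarrow> real" where
  "row_weight K u v = (\<Sum>i<K. paths K (2 * i + 1) u v)"

definition col_weight :: "nat \<Rightarrow> real \<Rightarrow> real \<Rightarrow> real" where
  "col_weight K u v = (\<Sum>i\<le>K. paths K (2 * i) u v)"

lemma ffact_Suc: "ffact x (Suc n) = ffact x n * (x - real n)"
  by (simp add: ffact_def)

lemma ffact_Suc_shift: "x * ffact (x - 1) n = ffact x (Suc n)"
  unfolding ffact_def prod.lessThan_Suc_shift by (simp add: algebra_simps)

lemma ffact_pred: "x * ffact (x - 1) n = ffact x n * (x - real n)"
  by (simp add: ffact_Suc_shift ffact_Suc)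

lemma ffact_eq_0: "m < n \<Longrightarrow> ffact (real m) n = 0"
  unfolding ffact_def by (intro prod_zero) auto

lemma abs_ffact_le:
  assumes "m \<le> K" "n \<le> K"
  shows "\<bar>ffact (real m) n\<bar> \<le> real K ^ n"
proof -
  have "\<bar>ffact (real m) n\<bar> = (\<Prod>i<n. \<bar>real m - real i\<bar>)" by (simp add: ffact_def abs_prod)
  also have "\<dots> \<le> (\<Prod>i<n. real K)" using assms by (intro prod_mono) auto
  finally show ?thesis by simp
qed

text \<open>Overlaps cost at most half of the cells. This yields positive denominators and a
  summable bound for \<open>paths\<close>.\<close>

lemma cross_size_ge:
  assumes "i \<le> 2 * K"
  shows "real i * real K / 2 \<le> cross_size K i"
proof -
  have "(i div 2) * ((i + 1) div 2) \<le> (i div 2) * K"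
    using assms by (intro mult_le_mono) auto
  then have "2 * ((i div 2) * ((i + 1) div 2)) \<le> 2 * (i div 2) * K" by simp
  also have "\<dots> \<le> i * K" by (intro mult_le_mono) auto
  finally have "2 * (real (i div 2) * real ((i + 1) div 2)) \<le> real i * real K"
    by (metis of_nat_le_iff of_nat_mult of_nat_numeral)
  then show ?thesis unfolding cross_size_def by linarith
qed

lemma cross_size_pos:
  assumes "1 \<le> i" "i \<le> 2 * K"
  shows "0 < cross_size K i"
proof -
  have "0 < real i * real K / 2" using assms by simp
  then show ?thesis using cross_size_ge[OF assms(2)] by linarith
qed

text \<open>The falling factorials choose \<open>l div 2\<close> unmet rows and
  \<open>(l + 1) div 2\<close> unmet columns. A revealed cell leaves all of them unmet unless it
  lies in one of these lines, and the number of such cells is \<open>cross_size K l\<close>, the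
  last term.\<close>

lemma paths_drift:
  "(u * v + u * (real K - v) + v * (real K - u)) * paths K l u v =
     u * v * paths K l (u - 1) (v - 1) + u * (real K - v) * paths K l (u - 1) v
     + v * (real K - u) * paths K l u (v - 1) + paths K l u v * cross_size K l"
proof -
  define h h' where "h = l div 2" and "h' = (l + 1) div 2"
  have "l = h + h'" unfolding h_def h'_def by linarith
  then have l: "real l = real h + real h'" by simp
  define P where "P = (\<Prod>i=1..l. cross_size K i)"
  have paths: "paths K l x y = ffact x h * ffact y h' / P" for x y
    by (simp add: paths_def h_def h'_def P_def)
  have u: "u * ffact (u - 1) h = ffact u h * (u - real h)"
    and v: "v * ffact (v - 1) h' = ffact v h' * (v - real h')" by (rule ffact_pred)+
  have "u * v * (ffact (u - 1) h * ffact (v - 1) h') + u * (real K - v) * (ffact (u - 1) h * ffact v h')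
     + v * (real K - u) * (ffact u h * ffact (v - 1) h')
     = (u * ffact (u - 1) h) * (v * ffact (v - 1) h') + (real K - v) * ((u * ffact (u - 1) h) * ffact v h')
     + (real K - u) * (ffact u h * (v * ffact (v - 1) h'))"
    by (simp add: algebra_simps)
  also have "\<dots> + ffact u h * ffact v h' * cross_size K l =
      (u * v + u * (real K - v) + v * (real K - u)) * (ffact u h * ffact v h')"
    unfolding u v cross_size_def l h_def[symmetric] h'_def[symmetric] by (simp add: algebra_simps)
  finally have *: "u * v * (ffact (u - 1) h * ffact (v - 1) h') + u * (real K - v) * (ffact (u - 1) h * ffact v h')
     + v * (real K - u) * (ffact u h * ffact (v - 1) h') + ffact u h * ffact v h' * cross_size K l
     = (u * v + u * (real K - v) + v * (real K - u)) * (ffact u h * ffact v h')" .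
  show ?thesis unfolding paths using arg_cong[OF *, of "\<lambda>t. t / P"]
    by (simp add: add_divide_distrib)
qed

text \<open>Splitting off the line next to the target: \<open>u\<close> counts the rows that may
  attach to the given column, and the rest is a path to that row.\<close>

lemma paths_even_Suc:
  assumes "i < K"
  shows "paths K (2 * Suc i) u v * cross_size K (2 * Suc i) = u * paths K (2 * i + 1) (u - 1) v"
proof -
  have "cross_size K (2 * Suc i) \<noteq> 0" using cross_size_pos[of "2 * Suc i" K] assms by simp
  then show ?thesis
    by (simp add: paths_def ffact_Suc_shift[symmetric])
qed

lemma paths_odd_Suc:
  assumes "i < K"
  shows "paths K (2 * i + 1) u v * cross_size K (2 * i + 1) = v * paths K (2 * i) u (v - 1)"
proof -
  have "cross_size K (2 * i + 1) \<noteq> 0" using cross_size_pos[of "2 * i + 1" K] assms by simp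
  then show ?thesis
    by (simp add: paths_def ffact_Suc_shift[symmetric])
qed

text \<open>The loss terms of \<open>paths_drift\<close>, shifted by one length, are the value of
  the rows that attach to the given column. Length 0 loses nothing, as
  \<open>cross_size K 0 = 0\<close>.\<close>

lemma col_weight_drift:
  "(u * v + u * (real K - v) + v * (real K - u)) * col_weight K u v =
     u * v * col_weight K (u - 1) (v - 1) + u * (real K - v) * col_weight K (u - 1) v
     + v * (real K - u) * col_weight K u (v - 1) + u * row_weight K (u - 1) v"
proof -
  have "(\<Sum>i\<le>K. paths K (2 * i) u v * cross_size K (2 * i)) =
      (\<Sum>i<K. paths K (2 * Suc i) u v * cross_size K (2 * Suc i))"
    unfolding sum.atMost_shift by (simp add: cross_size_def)
  also have "\<dots> = u * row_weight K (u - 1) v"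
    unfolding row_weight_def sum_distrib_left by (intro sum.cong refl paths_even_Suc) simp
  finally have eq: "(\<Sum>i\<le>K. paths K (2 * i) u v * cross_size K (2 * i)) = u * row_weight K (u - 1) v" .
  show ?thesis unfolding eq[symmetric]
    by (simp only: col_weight_def sum_distrib_left paths_drift sum.distrib)
qed

lemma row_weight_drift:
  assumes "v \<le> K"
  shows "(u * real v + u * (real K - real v) + real v * (real K - u)) * row_weight K u (real v) =
     u * real v * row_weight K (u - 1) (real v - 1) + u * (real K - real v) * row_weight K (u - 1) (real v)
     + real v * (real K - u) * row_weight K u (real v - 1) + real v * col_weight K u (real v - 1)"
proof -
  \<comment> \<open>The longest term of \<open>col_weight\<close> has no partner in
    \<open>row_weight\<close>; it vanishes, since it asks for \<open>K + 1\<close> distinct columns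
    among \<open>v \<le> K\<close>.\<close>
  have "real v * ffact (real v - 1) K = 0" 
    using ffact_eq_0[of v "Suc K"] assms by (simp add: ffact_Suc_shift)
  then have "real v * paths K (2 * K) u (real v - 1) = 0" by (auto simp: paths_def)
  then have "real v * col_weight K u (real v - 1) = (\<Sum>i<K. real v * paths K (2 * i) u (real v - 1))"
    by (simp only: col_weight_def lessThan_Suc_atMost[symmetric] sum.lessThan_Suc distrib_left
        sum_distrib_left add_0_right)
  also have "\<dots> = (\<Sum>i<K. paths K (2 * i + 1) u (real v) * cross_size K (2 * i + 1))"
    by (intro sum.cong refl paths_odd_Suc[symmetric]) simp
  finally have eq: "real v * col_weight K u (real v - 1) =
    (\<Sum>i<K. paths K (2 * i + 1) u (real v) * cross_size K (2 * i + 1))" .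
  show ?thesis unfolding eq
    by (simp only: row_weight_def sum_distrib_left paths_drift sum.distrib)
qed

lemma paths_0: "0 < l \<Longrightarrow> paths K l 0 0 = 0"
proof -
  assume "0 < l"
  then have "ffact 0 ((l + 1) div 2) = 0" using ffact_eq_0[of 0 "(l + 1) div 2"] by simp
  then show ?thesis by (simp add: paths_def)
qed

text \<open>Terminal values: once all lines are met, a component is worth exactly its
  columns.\<close>

lemma row_weight_0: "row_weight K 0 0 = 0"
  by (simp add: row_weight_def paths_0)

lemma col_weight_0: "col_weight K 0 0 = 1"
proof -
  have "paths K (2 * i) 0 0 = (if i = 0 then 1 else 0)" for i
    using paths_0[of "2 * i" K] by (simp add: paths_def ffact_def)
  then show ?thesis by (simp add: col_weight_def)
qed

section \<open>Convergence of the weights to the exponential function\<close>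

lemma weights_eq: "row_weight K u v + col_weight K u v = (\<Sum>l\<le>2 * K. paths K l u v)"
proof -
  have "(\<Sum>l\<le>2 * m. f l) = (\<Sum>i<m. f (2 * i + 1)) + (\<Sum>i\<le>m. f (2 * i))" for f :: "nat \<Rightarrow> real" and m
    by (induction m) (simp_all add: algebra_simps)
  then show ?thesis by (simp add: row_weight_def col_weight_def)
qed

text \<open>The numerator has \<open>l\<close> factors of modulus at most \<open>K\<close>, and the
  denominator factors are at least \<open>i * K / 2\<close>. The bound sums to
  \<open>exp 2\<close>.\<close>

lemma abs_paths_le:
  assumes "u \<le> K" "v \<le> K" "l \<le> 2 * K"
  shows "\<bar>paths K l (real u) (real v)\<bar> \<le> 2 ^ l / fact l"
proof (cases "K = 0")
  case False
  have "(\<Prod>i=1..l. real i * real K / 2) \<le> (\<Prod>i=1..l. cross_size K i)"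
    using assms cross_size_ge by (intro prod_mono) auto
  moreover have "(\<Prod>i=1..l. real i * real K / 2) = fact l * real K ^ l / 2 ^ l"
    by (simp add: prod.distrib prod_dividef fact_prod)
  ultimately have P: "fact l * real K ^ l / 2 ^ l \<le> (\<Prod>i=1..l. cross_size K i)" by simp
  have pos: "0 < fact l * real K ^ l / 2 ^ l" using False by simp
  have "\<bar>ffact (real u) (l div 2)\<bar> * \<bar>ffact (real v) ((l + 1) div 2)\<bar>
      \<le> real K ^ (l div 2) * real K ^ ((l + 1) div 2)"
    using assms by (intro mult_mono abs_ffact_le) auto
  also have "\<dots> = real K ^ l"
    unfolding power_add[symmetric] by (rule arg_cong[where f = "\<lambda>i. real K ^ i"]) linarith
  finally have N: "\<bar>ffact (real u) (l div 2)\<bar> * \<bar>ffact (real v) ((l + 1) div 2)\<bar> \<le> real K ^ l" .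
  have "\<bar>paths K l (real u) (real v)\<bar> \<le> real K ^ l / (fact l * real K ^ l / 2 ^ l)"
    unfolding paths_def abs_divide abs_mult
    by (rule frac_le) (use N P pos in auto)
  also have "\<dots> = 2 ^ l / fact l" using False by simp
  finally show ?thesis .
qed (use assms in \<open>simp add: paths_def ffact_def\<close>)

text \<open>Divide all \<open>l\<close> factors above and below by \<open>\<kappa> i\<close>: those
  above tend to \<open>x\<close>, and factor \<open>k\<close> below tends to
  \<open>k\<close>.\<close>

lemma tendsto_paths:
  fixes \<kappa> u v :: "'i \<Rightarrow> nat"
  assumes \<kappa>: "filterlim \<kappa> at_top F"
    and u: "((\<lambda>i. real (u i) / real (\<kappa> i)) \<longlongrightarrow> x) F"
    and v: "((\<lambda>i. real (v i) / real (\<kappa> i)) \<longlongrightarrow> x) F"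
  shows "((\<lambda>i. paths (\<kappa> i) l (real (u i)) (real (v i))) \<longlongrightarrow> x ^ l / fact l) F"
proof -
  let ?h = "l div 2" and ?h' = "(l + 1) div 2"
  have \<kappa>r: "filterlim (\<lambda>i. real (\<kappa> i)) at_infinity F"
    using \<kappa> by (intro filterlim_at_top_imp_at_infinity filterlim_compose[OF filterlim_real_sequentially])
  have const: "((\<lambda>i. C / real (\<kappa> i)) \<longlongrightarrow> 0) F" for C
    by (rule tendsto_divide_0[OF tendsto_const \<kappa>r])
  have ff: "((\<lambda>i. \<Prod>k<m. (real (w i) - real k) / real (\<kappa> i)) \<longlongrightarrow> x ^ m) F"
    if "((\<lambda>i. real (w i) / real (\<kappa> i)) \<longlongrightarrow> x) F" for w :: "'i \<Rightarrow> nat" and m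
  proof -
    have "((\<lambda>i. \<Prod>k<m. real (w i) / real (\<kappa> i) - real k / real (\<kappa> i)) \<longlongrightarrow> (\<Prod>k<m. x - 0)) F"
      by (intro tendsto_intros that const)
    then show ?thesis by (simp add: diff_divide_distrib)
  qed
  have ev: "eventually (\<lambda>i. 1 \<le> \<kappa> i) F"
    using \<kappa> by (auto simp: filterlim_at_top)
  have "((\<lambda>i. \<Prod>k=1..l. real k - (real (k div 2) * real ((k + 1) div 2)) / real (\<kappa> i)) \<longlongrightarrow> (\<Prod>k=1..l. real k - 0)) F"
    by (intro tendsto_intros const)
  moreover have "eventually (\<lambda>i. (\<Prod>k=1..l. real k - (real (k div 2) * real ((k + 1) div 2)) / real (\<kappa> i))
      = (\<Prod>k=1..l. cross_size (\<kappa> i) k / real (\<kappa> i))) F"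
    using ev by eventually_elim (intro prod.cong refl, simp add: cross_size_def field_simps)
  ultimately have cs: "((\<lambda>i. \<Prod>k=1..l. cross_size (\<kappa> i) k / real (\<kappa> i)) \<longlongrightarrow> fact l) F"
    by (simp add: fact_prod filterlim_cong)
  have "((\<lambda>i. (\<Prod>k<?h. (real (u i) - real k) / real (\<kappa> i)) * (\<Prod>k<?h'. (real (v i) - real k) / real (\<kappa> i))
      / (\<Prod>k=1..l. cross_size (\<kappa> i) k / real (\<kappa> i))) \<longlongrightarrow> x ^ ?h * x ^ ?h' / fact l) F"
    by (intro tendsto_intros ff u v cs) simp
  moreover have "x ^ ?h * x ^ ?h' = x ^ l"
    unfolding power_add[symmetric] by (rule arg_cong[where f = "\<lambda>i. x ^ i"]) linarith
  moreover have "eventually (\<lambda>i. (\<Prod>k<?h. (real (u i) - real k) / real (\<kappa> i)) * (\<Prod>k<?h'. (real (v i) - real k) / real (\<kappa> i))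
      / (\<Prod>k=1..l. cross_size (\<kappa> i) k / real (\<kappa> i)) = paths (\<kappa> i) l (real (u i)) (real (v i))) F"
    using ev
  proof eventually_elim
    case (elim i)
    have "real (\<kappa> i) ^ ?h * real (\<kappa> i) ^ ?h' = real (\<kappa> i) ^ l"
      unfolding power_add[symmetric] by (rule arg_cong[where f = "\<lambda>j. real (\<kappa> i) ^ j"]) linarith
    then show ?case using elim
      by (simp add: prod_dividef paths_def ffact_def field_simps)
  qed
  ultimately show ?thesis by (simp add: filterlim_cong)
qed

text \<open>A newborn component has one row and one column, so this sum is its expected final number
  of columns. Odd and even lengths merge into one series, and Tannery's theorem gives its
  limit.\<close>

lemma tendsto_weights:
  fixes \<kappa> u v :: "'i \<Rightarrow> nat"
  assumes \<kappa>: "filterlim \<kappa> at_top F" and le: "\<And>i. u i \<le> \<kappa> i" "\<And>i. v i \<le> \<kappa> i"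
    and u: "((\<lambda>i. real (u i) / real (\<kappa> i)) \<longlongrightarrow> x) F"
    and v: "((\<lambda>i. real (v i) / real (\<kappa> i)) \<longlongrightarrow> x) F" and F: "F \<noteq> bot"
  shows "((\<lambda>i. row_weight (\<kappa> i) (real (u i)) (real (v i)) + col_weight (\<kappa> i) (real (u i)) (real (v i)))
    \<longlongrightarrow> exp x) F"
proof -
  \<comment> \<open>The sum is continued by zeros to a series; for fixed \<open>l\<close> the cutoff
    \<open>2 * \<kappa> i\<close> is eventually passed.\<close>
  let ?a = "\<lambda>l i. if l \<in> {..2 * \<kappa> i} then paths (\<kappa> i) l (real (u i)) (real (v i)) else 0"
  have lim: "(?a l \<longlongrightarrow> x ^ l / fact l) F" for l
  proof -
    have "eventually (\<lambda>i. l \<le> \<kappa> i) F" using \<kappa> by (auto simp: filterlim_at_top)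
    then have "eventually (\<lambda>i. paths (\<kappa> i) l (real (u i)) (real (v i)) = ?a l i) F"
      by eventually_elim simp
    then show ?thesis using tendsto_paths[OF \<kappa> u v] tendsto_cong by fast
  qed
  have sm: "summable (\<lambda>l. 2 ^ l / fact l :: real)"
    using summable_exp[of "2 :: real"] by (simp add: field_simps)
  have "((\<lambda>i. suminf (\<lambda>l. ?a l i)) \<longlongrightarrow> suminf (\<lambda>l. x ^ l / fact l)) F"
  proof (rule tannerys_theorem[THEN conjunct2, THEN conjunct2])
    show "eventually (\<lambda>(l, i). norm (?a l i) \<le> 2 ^ l / fact l) (at_top \<times>\<^sub>F F)"
      using abs_paths_le[OF le] by (intro always_eventually) auto
  qed (use lim sm F in auto)
  moreover have "suminf (\<lambda>l. ?a l i) = row_weight (\<kappa> i) (real (u i)) (real (v i)) + col_weight (\<kappa> i) (real (u i)) (real (v i))" for i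
    unfolding weights_eq by (rule sums_unique[symmetric], rule sums_If_finite_set) simp
  moreover have "suminf (\<lambda>l. x ^ l / fact l) = exp x"
    by (simp add: exp_def field_simps)
  ultimately show ?thesis by simp
qed

text \<open>The uniform form of the limit: counterexamples for radius \<open>1 / (n + 1)\<close> and
  \<open>K \<ge> n\<close> would form a sequence that contradicts
  \<open>tendsto_weights\<close>.\<close>

lemma weights_near_exp:
  assumes "0 < \<delta>"
  obtains \<rho> K\<^sub>0 where "0 < \<rho>"
    "\<And>K u v. K\<^sub>0 \<le> K \<Longrightarrow> u \<le> K \<Longrightarrow> v \<le> K \<Longrightarrow> \<bar>real u / real K - x\<bar> < \<rho> \<Longrightarrow> \<bar>real v / real K - x\<bar> < \<rho>
      \<Longrightarrow> \<bar>row_weight K (real u) (real v) + col_weight K (real u) (real v) - exp x\<bar> \<le> \<delta>"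
proof (rule ccontr)
  assume "\<not> thesis"
  note neg = this
  have "\<exists>K u v. n \<le> K \<and> u \<le> K \<and> v \<le> K \<and> \<bar>real u / real K - x\<bar> < inverse (real (Suc n))
      \<and> \<bar>real v / real K - x\<bar> < inverse (real (Suc n))
      \<and> \<delta> < \<bar>row_weight K (real u) (real v) + col_weight K (real u) (real v) - exp x\<bar>" for n
  proof (rule ccontr)
    assume "\<not> ?thesis"
    then have "\<And>K u v. n \<le> K \<Longrightarrow> u \<le> K \<Longrightarrow> v \<le> K \<Longrightarrow> \<bar>real u / real K - x\<bar> < inverse (real (Suc n))
      \<Longrightarrow> \<bar>real v / real K - x\<bar> < inverse (real (Suc n))
      \<Longrightarrow> \<bar>row_weight K (real u) (real v) + col_weight K (real u) (real v) - exp x\<bar> \<le> \<delta>"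
      by (meson not_le)
    moreover have "0 < inverse (real (Suc n))" by simp
    ultimately show False using neg that by blast
  qed
  then obtain \<kappa> u v where *: "\<And>n. n \<le> \<kappa> n" "\<And>n. u n \<le> \<kappa> n" "\<And>n. v n \<le> \<kappa> n"
      "\<And>n. \<bar>real (u n) / real (\<kappa> n) - x\<bar> < inverse (real (Suc n))"
      "\<And>n. \<bar>real (v n) / real (\<kappa> n) - x\<bar> < inverse (real (Suc n))"
      "\<And>n. \<delta> < \<bar>row_weight (\<kappa> n) (real (u n)) (real (v n)) + col_weight (\<kappa> n) (real (u n)) (real (v n)) - exp x\<bar>"
    by metis
  have lim: "w \<longlonglongrightarrow> x" if "\<And>n. \<bar>w n - x\<bar> < inverse (real (Suc n))" for w :: "nat \<Rightarrow> real"
    by (rule LIM_zero_cancel, rule Lim_null_comparison[OF _ LIMSEQ_inverse_real_of_nat])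
       (use that in \<open>auto intro!: always_eventually less_imp_le\<close>)
  have "filterlim \<kappa> at_top sequentially"
    by (rule filterlim_at_top_mono[OF filterlim_ident]) (simp add: *(1))
  from tendsto_weights[OF this *(2,3) lim[OF *(4)] lim[OF *(5)]]
  have "(\<lambda>n. \<bar>row_weight (\<kappa> n) (real (u n)) (real (v n)) + col_weight (\<kappa> n) (real (u n)) (real (v n)) - exp x\<bar>) \<longlonglongrightarrow> 0"
    by (intro tendsto_rabs_zero LIM_zero) simp
  then have "eventually (\<lambda>n. \<bar>row_weight (\<kappa> n) (real (u n)) (real (v n)) + col_weight (\<kappa> n) (real (u n)) (real (v n)) - exp x\<bar> < \<delta>) sequentially"
    using assms by (rule order_tendstoD)
  then show False using *(6) by (metis (mono_tags, lifting) eventually_sequentially less_asym order_refl)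
qed

lemma abs_weights_le:
  assumes "u \<le> K" "v \<le> K"
  shows "\<bar>row_weight K (real u) (real v) + col_weight K (real u) (real v)\<bar> \<le> exp 2"
proof -
  have sm: "(\<lambda>l. 2 ^ l / fact l :: real) sums exp 2"
    using exp_converges[of "2 :: real"] by (simp add: field_simps)
  have "\<bar>row_weight K (real u) (real v) + col_weight K (real u) (real v)\<bar> \<le> (\<Sum>l\<le>2 * K. 2 ^ l / fact l)"
    unfolding weights_eq by (rule order_trans[OF sum_abs sum_mono]) (use assms in \<open>simp add: abs_paths_le\<close>)
  also have "\<dots> \<le> exp 2"
    using sum_le_suminf[OF sums_summable[OF sm], of "{..2 * K}"] sums_unique[OF sm] by simp
  finally show ?thesis .
qed

section \<open>Concentration at the birth of a component\<close>

text \<open>\<open>u\<close> and \<open>v\<close> count the unmet rows and columns, and \<open>q\<close> the equilibria still to be met up to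
  \<open>\<eta>\<^sub>j\<close>.  Each of the \<open>u v\<close> cells in unmet lines is an equilibrium with probability
  \<open>1 / (2 K - 1)\<close>, so the base of the first square is a martingale, with increments in \<open>[-1, 1]\<close>; the
  difference \<open>u - v\<close> drifts towards 0; the last term pays for the variances of both.\<close>

definition deviation :: "nat \<Rightarrow> real \<Rightarrow> real \<Rightarrow> real \<Rightarrow> real \<Rightarrow> real" where
  "deviation K m u v q = (u * v / (2 * real K - 1) - q - m)^2 + (u - v)^2 + 2 * (u + v)"

text \<open>\<open>P\<close>, \<open>Q\<close> and \<open>S\<close> weigh the cells with both lines,
  only the row, only the column unmet. The first square grows by at most \<open>P + Q + S\<close>,
  the second by at most \<open>Q + S\<close>, and the linear term loses
  \<open>4 * P + 2 * Q + 2 * S\<close>.\<close>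

lemma deviation_drift:
  assumes K: "K \<ge> 1" and u: "0 \<le> u" "u \<le> real K" and v: "0 \<le> v" "v \<le> real K"
    and uv: "u * v = 0 \<or> 1 \<le> u + v"
  shows "u * v * deviation K m (u - 1) (v - 1) (q - 1) + u * (real K - v) * deviation K m (u - 1) v q
    + v * (real K - u) * deviation K m u (v - 1) q
    \<le> (u * v + u * (real K - v) + v * (real K - u)) * deviation K m u v q"
proof -
  define N where "N = 2 * real K - 1"
  have N: "N > 0" using K by (simp add: N_def)
  define w where "w = u * v / N - q - m"
  define e1 e2 e3 where "e1 = (2 * real K - u - v) / N" and "e2 = v / N" and "e3 = u / N"
  define P Q S where "P = u * v" and "Q = u * (real K - v)" and "S = v * (real K - u)"
  have nonneg: "0 \<le> P" "0 \<le> Q" "0 \<le> S" using u v by (simp_all add: P_def Q_def S_def)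
  have d1: "deviation K m (u - 1) (v - 1) (q - 1) = (w + e1)^2 + (u - v)^2 + 2 * (u + v - 2)"
  proof -
    have "(u - 1) * (v - 1) / N - (q - 1) - m = w + e1"
      using N by (simp add: w_def e1_def field_simps) (simp add: N_def algebra_simps)
    then show ?thesis unfolding deviation_def N_def[symmetric] by simp
  qed
  have d2: "deviation K m (u - 1) v q = (w - e2)^2 + (u - v - 1)^2 + 2 * (u + v - 1)"
  proof -
    have eq: "(u - 1) * v / N - q - m = w - e2"
      using N by (simp add: w_def e2_def field_simps)
    show ?thesis unfolding deviation_def N_def[symmetric] eq by (simp add: algebra_simps)
  qed
  have d3: "deviation K m u (v - 1) q = (w - e3)^2 + (u - v + 1)^2 + 2 * (u + v - 1)"
  proof -
    have eq: "u * (v - 1) / N - q - m = w - e3"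
      using N by (simp add: w_def e3_def field_simps)
    show ?thesis unfolding deviation_def N_def[symmetric] eq by (simp add: algebra_simps)
  qed
  have d0: "deviation K m u v q = w^2 + (u - v)^2 + 2 * (u + v)"
    by (simp add: deviation_def w_def N_def)
  have mart: "P * e1 = Q * e2 + S * e3"
    using N by (simp add: P_def Q_def S_def e1_def e2_def e3_def field_simps)
  have K1: "real K \<ge> 1" using K by simp
  \<comment> \<open>Here \<open>e1 \<le> 1\<close> amounts to \<open>u + v \<ge> 1\<close>; if this
    fails, the weight \<open>P\<close> is 0.\<close>
  have "P * e1^2 \<le> P"
  proof (cases "u * v = 0")
    case False
    then have "0 \<le> e1" "e1 \<le> 1" using uv u v N by (auto simp: e1_def N_def)
    then have "e1^2 \<le> 1" by (simp add: power_le_one)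
    then show ?thesis using mult_left_mono[of "e1^2" 1 P] nonneg by simp
  qed (auto simp: P_def)
  moreover have "Q * e2^2 \<le> Q"
  proof -
    have "0 \<le> e2" "e2 \<le> 1" using v N K1 by (auto simp: e2_def N_def)
    then have "e2^2 \<le> 1" by (simp add: power_le_one)
    then show ?thesis using mult_left_mono[of "e2^2" 1 Q] nonneg by simp
  qed
  moreover have "S * e3^2 \<le> S"
  proof -
    have "0 \<le> e3" "e3 \<le> 1" using u N K1 by (auto simp: e3_def N_def)
    then have "e3^2 \<le> 1" by (simp add: power_le_one)
    then show ?thesis using mult_left_mono[of "e3^2" 1 S] nonneg by simp
  qed
  \<comment> \<open>The pull of \<open>u - v\<close> towards 0: its contribution is a multiple of a
    square, with a favourable sign.\<close>
  moreover have "Q - S = real K * (u - v)" by (simp add: Q_def S_def algebra_simps)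
  then have "0 \<le> (u - v) * (Q - S)"
    by (simp add: mult.left_commute)
  moreover have "P * ((w + e1)^2 + (u - v)^2 + 2 * (u + v - 2)) + Q * ((w - e2)^2 + (u - v - 1)^2 + 2 * (u + v - 1))
      + S * ((w - e3)^2 + (u - v + 1)^2 + 2 * (u + v - 1))
    = (P + Q + S) * (w^2 + (u - v)^2 + 2 * (u + v)) + 2 * w * (P * e1 - (Q * e2 + S * e3))
      + (P * e1^2 + Q * e2^2 + S * e3^2) - 2 * ((u - v) * (Q - S)) - 4 * P - Q - S"
    by (simp add: power2_eq_square algebra_simps)
  ultimately show ?thesis
    unfolding d0 d1 d2 d3 P_def[symmetric] Q_def[symmetric] S_def[symmetric] mart using nonneg by simp
qed

section \<open>Comparison functions for the expected component size\<close>

lemma weights_superharmonic: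
  fixes u v \<rho> \<gamma> K :: nat and s :: real
  assumes "v \<le> K"
  defines "h \<equiv> \<lambda>u v \<rho> \<gamma>. s * (row_weight K (real u) (real v) * real \<rho> + col_weight K (real u) (real v) * real \<gamma>)"
  shows "real u * real v * h (u - 1) (v - 1) \<rho> \<gamma>
    + real u * (real \<gamma> * h (u - 1) v (\<rho> + 1) \<gamma> + (real K - real v - real \<gamma>) * h (u - 1) v \<rho> \<gamma>)
    + real v * (real \<rho> * h u (v - 1) \<rho> (\<gamma> + 1) + (real K - real u - real \<rho>) * h u (v - 1) \<rho> \<gamma>)
    = (real u * real v + real u * (real K - real v) + real v * (real K - real u)) * h u v \<rho> \<gamma>"
    (is "_ = ?D * _")
proof -
  let ?a = "\<lambda>u v. row_weight K (real u) (real v)" and ?b = "\<lambda>u v. col_weight K (real u) (real v)"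
  \<comment> \<open>Truncated \<open>u - 1\<close> and \<open>v - 1\<close> are harmless, because
    each such term carries a factor \<open>u\<close> or \<open>v\<close> that is then 0. The last
    terms of \<open>a\<close> and \<open>b\<close> balance the lines that join the
    component.\<close>
  have a: "?D * ?a u v = real u * real v * ?a (u - 1) (v - 1) + real u * (real K - real v) * ?a (u - 1) v
     + real v * (real K - real u) * ?a u (v - 1) + real v * ?b u (v - 1)"
    unfolding row_weight_drift[OF assms(1)]
    by (cases "u = 0"; cases "v = 0") (simp_all add: of_nat_diff)
  have b: "?D * ?b u v = real u * real v * ?b (u - 1) (v - 1) + real u * (real K - real v) * ?b (u - 1) v
     + real v * (real K - real u) * ?b u (v - 1) + real u * ?a (u - 1) v"
    unfolding col_weight_drift
    by (cases "u = 0"; cases "v = 0") (simp_all add: of_nat_diff)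
  have "?D * h u v \<rho> \<gamma> = s * (real \<rho> * (?D * ?a u v) + real \<gamma> * (?D * ?b u v))"
    by (simp add: h_def algebra_simps)
  then show ?thesis unfolding a b by (simp add: h_def algebra_simps)
qed

text \<open>\<open>near\<close> is used at the birth of equilibrium \<open>j\<close>, where the
  count \<open>q\<close> of equilibria still to come reaches 0; \<open>never\<close> is used if the
  exploration ends before that birth. The choice of \<open>m\<close> makes the first square vanish
  at the start, so the initial deviation is \<open>4 * real K\<close>.\<close>

lemma perm_avg_explore_near:
  fixes K j :: nat and A \<delta> c :: real
  defines "m \<equiv> (real K)^2 / (2 * real K - 1) - real j"
  assumes K: "K \<ge> 1" and j: "j \<ge> 1" and A: "0 \<le> A"
    and near: "\<And>u v. u \<le> K \<Longrightarrow> v \<le> K \<Longrightarrow>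
      \<bar>row_weight K (real u) (real v) + col_weight K (real u) (real v) - c\<bar> \<le> \<delta> + A * deviation K m (real u) (real v) 0"
    and never: "\<And>q. 1 \<le> q \<Longrightarrow> \<bar>c\<bar> \<le> \<delta> + A * deviation K m 0 0 (real q)"
  shows "\<bar>perm_avg ({1..K} \<times> {1..K}) (\<lambda>xs. real (card (component_cols (explore j xs)))) - c\<bar> \<le> \<delta> + A * (4 * real K)"
proof -
  have bound: "perm_avg ({1..K} \<times> {1..K}) (\<lambda>xs. s * real (card (component_cols (explore j xs))))
      \<le> s * c + \<delta> + A * (4 * real K)" if s: "s = 1 \<or> s = - 1" for s :: real
  proof -
    \<comment> \<open>After the birth this is the exact expected size, before it the target with its
      error; \<open>s = 1\<close> gives the upper bound and \<open>s = - 1\<close> the lower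
      one.\<close>
    define h where "h = (\<lambda>u v n \<rho> \<gamma>. if j \<le> n
      then s * (row_weight K (real u) (real v) * real \<rho> + col_weight K (real u) (real v) * real \<gamma>)
      else s * c + \<delta> + A * deviation K m (real u) (real v) (real (j - n)))"
    have "perm_avg ({1..K} \<times> {1..K}) (\<lambda>xs. s * real (card (component_cols (explore j xs)))) \<le> h K K 0 0 0"
    proof (rule explore_superharmonic[where h = h and val = "\<lambda>i. s * real i"])
      fix u v n \<rho> \<gamma> d :: nat
      assume u: "u \<le> K" and v: "v \<le> K" and pre: "n < j \<longrightarrow> \<rho> = 0 \<and> \<gamma> = 0" and d: "d = of_bool (Suc n = j)"
      let ?D = "real u * real v + real u * (real K - real v) + real v * (real K - real u)"
      show "real u * real v * h (u - 1) (v - 1) (Suc n) (\<rho> + d) (\<gamma> + d)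
        + real u * (real \<gamma> * h (u - 1) v n (\<rho> + 1) \<gamma> + (real K - real v - real \<gamma>) * h (u - 1) v n \<rho> \<gamma>)
        + real v * (real \<rho> * h u (v - 1) n \<rho> (\<gamma> + 1) + (real K - real u - real \<rho>) * h u (v - 1) n \<rho> \<gamma>)
        \<le> ?D * h u v n \<rho> \<gamma>"
      proof (cases "j \<le> n")
        case True
        then have "d = 0" using d by simp
        then show ?thesis using True weights_superharmonic[OF v, of u s \<rho> \<gamma>] by (simp add: h_def)
      next
        case False
        define q where "q = real (j - n)"
        define G where "G = (\<lambda>u v q. s * c + \<delta> + A * deviation K m u v q)"
        have 0: "\<rho> = 0" "\<gamma> = 0" using pre False by auto
        have h0: "h u v n 0 0 = G (real u) (real v) q" for u v
          using False by (simp add: h_def G_def q_def)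
        have h1: "h u' v' (Suc n) d d \<le> G (real u') (real v') (q - 1)" if "u' \<le> K" "v' \<le> K" for u' v'
        proof (cases "Suc n = j")
          case True
          then have "q - 1 = 0" using j by (simp add: q_def)
          moreover have "h u' v' (Suc n) d d = s * (row_weight K (real u') (real v') + col_weight K (real u') (real v'))"
            using True d by (simp add: h_def)
          ultimately show ?thesis using near[OF that] s by (auto simp: G_def abs_le_iff)
        next
          case 2: False
          then have q: "q - 1 = real (j - Suc n)" using False by (simp add: q_def of_nat_diff)
          show ?thesis using False 2 d unfolding q by (simp add: h_def G_def)
        qed
        have "real u * real v * h (u - 1) (v - 1) (Suc n) d d
            \<le> real u * real v * G (real (u - 1)) (real (v - 1)) (q - 1)"
          using u v by (intro mult_left_mono h1) auto
        moreover have "real u * real v * G (real (u - 1)) (real (v - 1)) (q - 1)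
             + real u * (real K - real v) * G (real (u - 1)) (real v) q
             + real v * (real K - real u) * G (real u) (real (v - 1)) q
          = real u * real v * G (real u - 1) (real v - 1) (q - 1) + real u * (real K - real v) * G (real u - 1) (real v) q
             + real v * (real K - real u) * G (real u) (real v - 1) q"
          by (cases "u = 0"; cases "v = 0") (simp_all add: of_nat_diff)
        moreover have "real u * real v * G (real u - 1) (real v - 1) (q - 1) + real u * (real K - real v) * G (real u - 1) (real v) q
             + real v * (real K - real u) * G (real u) (real v - 1) q \<le> ?D * G (real u) (real v) q"
        proof -
          have "real u * real v = 0 \<or> 1 \<le> real u + real v" by (cases u) auto
          from mult_left_mono[OF deviation_drift[OF K _ _ _ _ this, of m q] A] u v
          show ?thesis by (simp add: G_def algebra_simps)
        qed
        ultimately show ?thesis by (simp add: 0 h0 algebra_simps)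
      qed
    next
      fix n \<rho> \<gamma> :: nat assume pre: "n < j \<longrightarrow> \<rho> = 0 \<and> \<gamma> = 0"
      show "s * real \<gamma> \<le> h 0 0 n \<rho> \<gamma>"
      proof (cases "j \<le> n")
        case True
        then show ?thesis by (simp add: h_def row_weight_0 col_weight_0)
      next
        case False
        then have "\<bar>c\<bar> \<le> \<delta> + A * deviation K m 0 0 (real (j - n))" by (intro never) simp
        then show ?thesis using pre False s by (auto simp: h_def)
      qed
    qed (rule K)
    also have "h K K 0 0 0 = s * c + \<delta> + A * (4 * real K)"
      using j by (simp add: h_def deviation_def m_def power2_eq_square)
    finally show ?thesis .
  qed
  have "perm_avg S (\<lambda>xs. - 1 * f xs) = - perm_avg S f" for S :: "(nat \<times> nat) set" and f
    by (simp add: perm_avg_def sum_negf)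
  then show ?thesis using bound[of 1] bound[of "- 1"] by (simp add: abs_le_iff)
qed

section \<open>Small deviation forces both unmet fractions close to \<open>x\<close>\<close>

lemma near_root:
  fixes x p q :: real
  assumes x: "0 < x" and p: "0 \<le> p" "p \<le> 1" and "\<bar>p * q - x^2\<bar> \<le> a" "\<bar>p - q\<bar> \<le> b" "a + b < \<rho> * x"
  shows "\<bar>p - x\<bar> < \<rho>"
proof -
  have "\<bar>p - x\<bar> * x \<le> \<bar>p - x\<bar> * (p + x)" using p by (intro mult_left_mono) auto
  also have "\<dots> = \<bar>p^2 - x^2\<bar>"
    using x p by (simp add: power2_eq_square square_diff_square_factored abs_mult mult.commute)
  \<comment> \<open>As \<open>p\<close> is close to \<open>q\<close>, its square is close to
    \<open>p * q\<close> and thus to \<open>x^2\<close>; the factor \<open>p + x \<ge> x\<close>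
    then bounds \<open>p - x\<close>.\<close>
  also have "p^2 - x^2 = (p * q - x^2) + p * (p - q)" by (simp add: power2_eq_square algebra_simps)
  also have "\<bar>\<dots>\<bar> \<le> a + 1 * b"
  proof (rule order_trans[OF abs_triangle_ineq add_mono])
    show "\<bar>p * (p - q)\<bar> \<le> 1 * b" unfolding abs_mult using assms by (intro mult_mono) auto
  qed fact
  also have "\<dots> < \<rho> * x" using assms by simp
  finally show ?thesis using x by simp
qed

text \<open>Each square is below \<open>(\<tau> * real K)^2\<close>. In the first one, replacing
  \<open>2 * real K - 1\<close> by \<open>2 * real K\<close> costs at most \<open>1 / 2\<close>, and
  \<open>j\<close> by \<open>\<epsilon> * real K\<close> at most 1. Scaling by
  \<open>2 / real K\<close> gives the error \<open>2 * \<tau> + 3 / real K\<close>, and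
  \<open>u - v\<close> adds another \<open>\<tau>\<close>.\<close>

lemma near_of_deviation_less:
  fixes \<epsilon> \<rho> \<tau> x :: real and K u v j :: nat
  assumes x: "0 < x" "x^2 = 1 - 2 * \<epsilon>" and \<tau>: "0 < \<tau>" "3 * \<tau> + 3 / real K < \<rho> * x"
    and K: "K \<ge> 1" and le: "u \<le> K" "v \<le> K" and j: "real j \<le> \<epsilon> * real K" "\<epsilon> * real K < real j + 1"
    and dev: "deviation K ((real K)^2 / (2 * real K - 1) - real j) (real u) (real v) 0 < (\<tau> * real K)^2"
  shows "\<bar>real u / real K - x\<bar> < \<rho>" "\<bar>real v / real K - x\<bar> < \<rho>"
proof -
  let ?m = "(real K)^2 / (2 * real K - 1) - real j"
  let ?p = "real u / real K" and ?q = "real v / real K"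
  have K1: "real K \<ge> 1" using K by simp
  have dev': "(real u * real v / (2 * real K - 1) - ?m)^2 + (real u - real v)^2 < (\<tau> * real K)^2"
    using dev by (simp add: deviation_def)
  then have "\<bar>real u * real v / (2 * real K - 1) - ?m\<bar>^2 < (\<tau> * real K)^2"
    unfolding power2_abs using zero_le_power2[of "real u - real v"] by linarith
  then have a: "\<bar>real u * real v / (2 * real K - 1) - ?m\<bar> < \<tau> * real K"
    by (rule power2_less_imp_less) (use \<tau> in simp)
  have "\<bar>real u - real v\<bar>^2 < (\<tau> * real K)^2"
    unfolding power2_abs using dev' zero_le_power2[of "real u * real v / (2 * real K - 1) - ?m"] by linarith
  then have "\<bar>real u - real v\<bar> < \<tau> * real K"
    by (rule power2_less_imp_less) (use \<tau> in simp)
  moreover have "\<bar>?p - ?q\<bar> = \<bar>real u - real v\<bar> / real K"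
    using K1 by (simp add: diff_divide_distrib[symmetric])
  ultimately have b: "\<bar>?p - ?q\<bar> \<le> \<tau>" using K1 by (simp add: field_simps)
  define y where "y = (real K)^2 - real u * real v"
  have "real u * real v \<le> (real K)^2"
    unfolding power2_eq_square using le by (intro mult_mono) auto
  then have y: "0 \<le> y" "y \<le> (real K)^2" by (auto simp: y_def)
  have "real u * real v / (2 * real K - 1) - ?m = real j - y / (2 * real K - 1)"
    by (simp add: y_def diff_divide_distrib)
  moreover have "y / (2 * real K - 1) - y / (2 * real K) = y / (2 * real K * (2 * real K - 1))"
    using K1 by (simp add: field_simps)
  moreover have "y / (2 * real K * (2 * real K - 1)) \<le> 1 / 2"
  proof -
    have "y \<le> real K * real K" using y by (simp add: power2_eq_square)
    also have "\<dots> \<le> real K * (2 * real K - 1)" using K1 by (intro mult_left_mono) auto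
    finally show ?thesis using K1 by (simp add: divide_le_eq)
  qed
  moreover have "0 \<le> y / (2 * real K * (2 * real K - 1))" using y K1 by simp
  ultimately have "\<bar>\<epsilon> * real K - y / (2 * real K)\<bar> \<le> \<tau> * real K + 3 / 2"
    using a j unfolding abs_le_iff abs_less_iff by linarith
  then have "\<bar>\<epsilon> * real K - y / (2 * real K)\<bar> * (2 / real K) \<le> (\<tau> * real K + 3 / 2) * (2 / real K)"
    using K1 by (intro mult_right_mono) auto
  moreover have "\<bar>\<epsilon> * real K - y / (2 * real K)\<bar> * (2 / real K) = \<bar>?p * ?q - x^2\<bar>"
  proof -
    have "\<bar>\<epsilon> * real K - y / (2 * real K)\<bar> * (2 / real K) = \<bar>(\<epsilon> * real K - y / (2 * real K)) * (2 / real K)\<bar>"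
      unfolding abs_mult using K1 by simp
    also have "(\<epsilon> * real K - y / (2 * real K)) * (2 / real K) = ?p * ?q - x^2"
      unfolding x(2) y_def using K1 by (simp add: field_simps power2_eq_square)
    finally show ?thesis .
  qed
  moreover have "(\<tau> * real K + 3 / 2) * (2 / real K) = 2 * \<tau> + 3 / real K"
    using K1 by (simp add: field_simps)
  ultimately have pq: "\<bar>?p * ?q - x^2\<bar> \<le> 2 * \<tau> + 3 / real K" by simp
  have p: "0 \<le> ?p" "?p \<le> 1" "0 \<le> ?q" "?q \<le> 1" using le K1 by auto
  have sum: "2 * \<tau> + 3 / real K + \<tau> < \<rho> * x" using \<tau> by simp
  show "\<bar>?p - x\<bar> < \<rho>" by (rule near_root[OF x(1) p(1,2) pq b sum])
  show "\<bar>?q - x\<bar> < \<rho>"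
    by (rule near_root[OF x(1) p(3,4) _ _ sum, of ?p])
       (use pq b in \<open>simp_all add: mult.commute abs_minus_commute\<close>)
qed

section \<open>The limit of the normalised expectation\<close>

theorem theorem4p4:
  fixes \<epsilon> :: real
  assumes "0 < \<epsilon>" and "\<epsilon> < 1/2"
  shows "(\<lambda>K. expect_pot K (\<lambda>\<Psi>. real (boa_size \<Psi> K (nat \<lfloor>\<epsilon> * real K\<rfloor>)) / real K))
           \<longlonglongrightarrow> exp (sqrt (1 - 2 * \<epsilon>))"
proof -
  define x where "x = sqrt (1 - 2 * \<epsilon>)"
  have x: "0 < x" "x^2 = 1 - 2 * \<epsilon>" using assms by (simp_all add: x_def)
  let ?E = "\<lambda>K. expect_pot K (\<lambda>\<Psi>. real (boa_size \<Psi> K (nat \<lfloor>\<epsilon> * real K\<rfloor>)) / real K)"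
  have "?E \<longlonglongrightarrow> exp x"
  proof (rule tendstoI)
    fix e :: real assume e: "0 < e"
    define \<delta> where "\<delta> = e / 2"
    have \<delta>: "0 < \<delta>" using e by (simp add: \<delta>_def)
    obtain \<rho> K\<^sub>0 where \<rho>: "0 < \<rho>" and close:
      "\<And>K u v. K\<^sub>0 \<le> K \<Longrightarrow> u \<le> K \<Longrightarrow> v \<le> K \<Longrightarrow> \<bar>real u / real K - x\<bar> < \<rho> \<Longrightarrow> \<bar>real v / real K - x\<bar> < \<rho>
      \<Longrightarrow> \<bar>row_weight K (real u) (real v) + col_weight K (real u) (real v) - exp x\<bar> \<le> \<delta>"
      using weights_near_exp[OF \<delta>, of x] by metis
    \<comment> \<open>With \<open>K \<ge> 8 / (\<rho> * x)\<close> both \<open>3 * \<tau>\<close>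
      and \<open>3 / real K\<close> are at most \<open>3 / 8\<close> of
      \<open>\<rho> * x\<close>.\<close>
    define \<tau> where "\<tau> = \<rho> * x / 8"
    have \<tau>: "0 < \<tau>" using \<rho> x by (simp add: \<tau>_def)
    \<comment> \<open>The first summand pays for pairs \<open>u\<close>, \<open>v\<close> with large
      deviation, the second for explorations that never meet equilibrium \<open>j\<close>. Used with
      the factor \<open>1 / (real K)^2\<close>, it leaves an error of
      \<open>4 * A / real K\<close>.\<close>
    define A where "A = (exp 2 + exp x) / \<tau>^2 + 4 * exp x / (x^2)^2"
    have A: "0 \<le> A" "(exp 2 + exp x) / \<tau>^2 \<le> A" "4 * exp x / (x^2)^2 \<le> A"
      by (simp_all add: A_def)
    have ev: "eventually (\<lambda>K. C \<le> real K) sequentially" for C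
      using filterlim_real_sequentially by (auto simp: filterlim_at_top)
    have "eventually (\<lambda>K. K\<^sub>0 \<le> K) sequentially" "eventually (\<lambda>K. 1 \<le> K) sequentially"
      by (rule eventually_ge_at_top)+
    \<comment> \<open>The thresholds ensure in turn \<open>j \<ge> 1\<close>, the room needed for
      \<open>near_of_deviation_less\<close>, and a final error below
      \<open>\<delta>\<close>.\<close>
    then show "eventually (\<lambda>K. dist (?E K) (exp x) < e) sequentially"
      using ev[of "1 / \<epsilon>"] ev[of "8 / (\<rho> * x)"] ev[of "8 * A / \<delta> + 1"]
    proof eventually_elim
      case (elim K)
      note K = elim(2)
      have K1: "real K \<ge> 1" using K by simp
      define j where "j = nat \<lfloor>\<epsilon> * real K\<rfloor>"
      have \<epsilon>K: "1 \<le> \<epsilon> * real K" using elim(3) assms by (simp add: field_simps)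
      then have "1 \<le> \<lfloor>\<epsilon> * real K\<rfloor>" by simp
      then have j: "j \<ge> 1" "real j \<le> \<epsilon> * real K" "\<epsilon> * real K < real j + 1"
        unfolding j_def by linarith+
      define m where "m = (real K)^2 / (2 * real K - 1) - real j"
      have \<tau>K: "3 * \<tau> + 3 / real K < \<rho> * x"
      proof -
        have "8 / real K \<le> \<rho> * x" using elim(4) \<rho> x K1 by (simp add: field_simps)
        moreover have "3 / real K = 3 / 8 * (8 / real K)" by simp
        moreover have "0 < \<rho> * x" "3 * \<tau> = 3 / 8 * (\<rho> * x)" using \<rho> x by (simp_all add: \<tau>_def)
        ultimately show ?thesis by linarith
      qed
      have dev_nonneg: "0 \<le> deviation K m (real u) (real v) q" for u v q
        by (simp add: deviation_def)
      have near: "\<bar>row_weight K (real u) (real v) + col_weight K (real u) (real v) - exp x\<bar>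
        \<le> \<delta> + A / (real K)^2 * deviation K m (real u) (real v) 0" if uv: "u \<le> K" "v \<le> K" for u v
      proof (cases "deviation K m (real u) (real v) 0 < (\<tau> * real K)^2")
        case True
        have "\<bar>row_weight K (real u) (real v) + col_weight K (real u) (real v) - exp x\<bar> \<le> \<delta>"
          using near_of_deviation_less[OF x \<tau> \<tau>K K uv j(2,3)] True close[OF elim(1) uv] by (simp add: m_def)
        moreover have "0 \<le> A / (real K)^2 * deviation K m (real u) (real v) 0"
          using A dev_nonneg by simp
        ultimately show ?thesis by linarith
      next
        case False
        have "\<bar>row_weight K (real u) (real v) + col_weight K (real u) (real v) - exp x\<bar> \<le> exp 2 + exp x"
          using abs_weights_le[OF uv] exp_gt_zero[of x] by linarith
        also have "\<dots> \<le> A / (real K)^2 * (\<tau> * real K)^2"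
          using A(2) \<tau> K1 by (simp add: power_mult_distrib field_simps)
        also have "\<dots> \<le> A / (real K)^2 * deviation K m (real u) (real v) 0"
          using False A by (intro mult_left_mono) auto
        finally show ?thesis using \<delta> by linarith
      qed
      have never: "\<bar>exp x\<bar> \<le> \<delta> + A / (real K)^2 * deviation K m 0 0 (real q)" for q :: nat
      proof -
        \<comment> \<open>Missing equilibrium \<open>j\<close> with no line left means a martingale
          error of at least \<open>real K * x^2 / 2\<close>, of order \<open>K\<close>, so its
          square outweighs the factor \<open>1 / (real K)^2\<close>.\<close>
        have "real K / 2 \<le> (real K)^2 / (2 * real K - 1)"
          using K1 by (simp add: field_simps power2_eq_square)
        moreover have "real K * x^2 / 2 = real K / 2 - \<epsilon> * real K"
          unfolding x(2) by (simp add: field_simps)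
        ultimately have "real K * x^2 / 2 \<le> m" using j unfolding m_def by linarith
        then have "real K * x^2 / 2 \<le> real q + m" by simp
        then have "(real K * x^2 / 2)^2 \<le> (real q + m)^2" by (intro power_mono) auto
        also have "\<dots> = deviation K m 0 0 (real q)"
          by (simp add: deviation_def power2_eq_square algebra_simps)
        finally have dev: "(real K * x^2 / 2)^2 \<le> deviation K m 0 0 (real q)" .
        have "exp x \<le> A / (real K)^2 * (real K * x^2 / 2)^2"
          using A(3) x(1) K1 by (simp add: power_mult_distrib power_divide field_simps)
        also have "\<dots> \<le> A / (real K)^2 * deviation K m 0 0 (real q)"
          using dev A by (intro mult_left_mono) auto
        finally show ?thesis using \<delta> by simp
      qed
      have "\<bar>?E K - exp x\<bar> \<le> \<delta> + A / (real K)^2 * (4 * real K)"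
        unfolding expect_boa_size[OF K] j_def[symmetric]
        using A by (intro perm_avg_explore_near K j near[unfolded m_def] never[unfolded m_def]) auto
      also have "\<delta> + A / (real K)^2 * (4 * real K) = \<delta> + 4 * A / real K"
        using K1 by (simp add: power2_eq_square)
      also have "\<dots> < e"
      proof -
        have "8 * A / \<delta> < real K" using elim(5) by simp
        then have "8 * A < \<delta> * real K" using \<delta> by (simp add: field_simps)
        then have "4 * A < \<delta> * real K" using A(1) by simp
        then have "4 * A / real K < \<delta>" using K1 by (simp add: field_simps)
        then show ?thesis by (simp add: \<delta>_def)
      qed
      finally show ?case by (simp add: dist_real_def)
    qed
  qed
  then show ?thesis by (simp add: x_def)
qed

end
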